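(* Let $\mathcal B\subset\mathbb N_{\geq2}$ be a finite set with $\#\mathcal B\geq2$ and $2\in\mathcal B$. Then \[\lim_{\alpha\to2+0}\dim_{\rm H}\big(G(\alpha)\cap F_{\mathcal B}\big)=\dim_{\rm H}F_{\mathcal B}.\]
   Context: For $x\in\mathbb R$, the irrationality exponent $\mu(x)$ is the supremum of the set of $\mu\in\mathbb R$ such that $|x-p/q|<q^{-\mu}$ holds for infinitely many $(p,q)\in\mathbb Z\times\mathbb N$ with $|p|$ and $q$ coprime. For $\alpha>2$, the Jarník set is $G(\alpha)=\{x\in\mathbb R\setminus\mathbb Q:\mu(x)\geq\alpha\}$. Every irrational $x$ has a unique backward continued fraction (BCF) expansion $x=b_0(x)-\cfrac{1}{b_1(x)-\cfrac{1}{b_2(x)-\cdots}}$ with $b_0(x)=\lfloor x\rfloor+1$ and integers $b_n(x)\geq2$ for $n\geq1$. For a finite $\mathcal B\subset\mathbb N_{\geq2}$, $F_{\mathcal B}=\{x\in(0,1)\setminus\mathbb Q: b_n(x)\in\mathcal B\text{ for all }n\geq1\}$. $\dim_{\rm H}$ denotes Hausdorff dimension on $\mathbb R$. *)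

theory Defs
  imports "HOL-Analysis.Analysis"
begin

definition cover_term :: "real \<Rightarrow> real set \<Rightarrow> ennreal" where
  "cover_term s U = (if U = {} then 0 else if s = 0 then 1 else ennreal (diameter U powr s))"

definition hausdorff_content :: "real \<Rightarrow> real \<Rightarrow> real set \<Rightarrow> ennreal" where
  "hausdorff_content s \<delta> E =
     (INF U \<in> {U :: nat \<Rightarrow> real set. E \<subseteq> (\<Union>i. U i) \<and>
                 (\<forall>i. bounded (U i) \<and> diameter (U i) \<le> \<delta>)}.
        (\<Sum>i. cover_term s (U i)))"

definition hausdorff_measure :: "real \<Rightarrow> real set \<Rightarrow> ennreal" where
  "hausdorff_measure s E = (SUP \<delta> \<in> {0<..}. hausdorff_content s \<delta> E)"

definition hausdorff_dim :: "real set \<Rightarrow> real" where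
  "hausdorff_dim E = Inf {s. 0 \<le> s \<and> hausdorff_measure s E = 0}"

definition irrationality_exponent :: "real \<Rightarrow> ereal" where
  "irrationality_exponent x =
     Sup {ereal \<mu> | \<mu>. infinite {(p :: int, q :: nat). 0 < q \<and> coprime \<bar>p\<bar> (int q) \<and>
                          \<bar>x - real_of_int p / real q\<bar> < real q powr (- \<mu>)}}"

definition jarnik_set :: "real \<Rightarrow> real set" where
  "jarnik_set \<alpha> = {x. x \<notin> \<rat> \<and> irrationality_exponent x \<ge> ereal \<alpha>}"

text \<open>x = b0(x) - 1/T(x) with b0(x) = floor x + 1, so T(x) = 1/(b0(x) - x).\<close>
definition bcf_b0 :: "real \<Rightarrow> int" where
  "bcf_b0 x = \<lfloor>x\<rfloor> + 1"

definition bcf_shift :: "real \<Rightarrow> real" where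
  "bcf_shift x = 1 / (real_of_int (bcf_b0 x) - x)"

definition bcf_digit :: "nat \<Rightarrow> real \<Rightarrow> int" where
  "bcf_digit n x = bcf_b0 ((bcf_shift ^^ n) x)"

definition F_set :: "nat set \<Rightarrow> real set" where
  "F_set B = {x. 0 < x \<and> x < 1 \<and> x \<notin> \<rat> \<and> (\<forall>n\<ge>1. bcf_digit n x \<in> int ` B)}"

end

theory Submission
  imports Defs
begin

text \<open>
  Write \<open>G\<close> for the Jarnik set of exponent \<open>2 + e\<close> and \<open>F\<close> for the digit set. A point of \<open>F\<close> outside \<open>G\<close>
  satisfies \<open>\<bar>x - p/q\<bar> \<ge> c / q^(2 + e)\<close> for some \<open>c > 0\<close>. Inserting into its expansion very sparse long
  runs of the digit 2 (near which \<open>(num - num') / (den - den')\<close> is a very good approximation) yields a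
  point of \<open>G \<inter> F\<close>. The lower bound on \<open>\<bar>x - p/q\<bar>\<close> makes \<open>den\<close> and \<open>den - den'\<close> comparable up to the
  power \<open>1 + e\<close>, so the inverse of the insertion is Hoelder with exponent \<open>\<gamma> = 1 / (1 + e)^4\<close>.
  Hence \<open>\<gamma> dim F \<le> dim (G \<inter> F) \<le> dim F\<close>, and \<open>\<gamma>\<close> tends to 1 as \<open>e\<close> tends to 0.
\<close>

text \<open>The digit 2 is the obstacle. The map \<open>2 - 1 / t\<close> fixes 1 with derivative 1,
  so denominators grow only linearly along a run of 2s, and a concatenation can have a far smaller
  denominator than the product: \<open>k + r + 1\<close> against \<open>(k + 1) * (r + 1)\<close>
  for runs of lengths \<open>k\<close> and \<open>r\<close>. Distances between points with a common
  prefix are therefore bounded above through \<open>den - den'\<close> and below through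
  \<open>den\<close>, and these can differ widely. If they do, the point is very close to
  \<open>(num - num') / (den - den')\<close>. Outside G the discrepancy is thus limited to a power;
  points inside G need no transfer, because they already lie in the set whose dimension is
  estimated. The constant c depends on the point, so F minus G is split into countably many pieces
  with constants \<open>1 / (N + 1)\<close>. The power 4 in \<gamma> collects three factors
  \<open>1 + e\<close> from comparing new denominators with old ones, and one from bounding the old
  distance through \<open>den\<close> instead of \<open>den - den'\<close>.\<close>

section \<open>Null sets and Hausdorff dimension\<close>

definition hausdorff_null :: "real \<Rightarrow> real set \<Rightarrow> bool" where
  "hausdorff_null s E \<longleftrightarrow> (\<forall>\<epsilon>>0. \<exists>U :: nat \<Rightarrow> real set. E \<subseteq> (\<Union>i. U i) \<and> (\<forall>i. bounded (U i)) \<and>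
     (\<Sum>i. ennreal (diameter (U i) powr s)) < ennreal \<epsilon>)"

lemma cover_term_pos: "0 < s \<Longrightarrow> cover_term s U = ennreal (diameter U powr s)"
  by (auto simp: cover_term_def)

lemma diameter_powr_le_suminf:
  fixes U :: "nat \<Rightarrow> real set"
  shows "ennreal (diameter (U i) powr s) \<le> (\<Sum>i. ennreal (diameter (U i) powr s))"
  using sum_le_suminf[of "\<lambda>i. ennreal (diameter (U i) powr s)" "{i}"]
  by (simp only: sum.insert sum.empty finite.intros summableI zero_le simp_thms empty_iff add_0_right not_False_eq_True)

lemma hausdorff_content_eq_0_if_measure_eq_0:
  "hausdorff_measure s E = 0 \<Longrightarrow> 0 < \<delta> \<Longrightarrow> hausdorff_content s \<delta> E = 0"
  unfolding hausdorff_measure_def by (metis SUP_upper greaterThan_iff le_zero_eq)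

text \<open>For positive \<open>s\<close> the mesh bound comes for free: a sum below
  \<open>\<delta> powr s\<close> forces every diameter below \<open>\<delta>\<close>. This is why
  \<open>hausdorff_null\<close> can do without a \<open>\<delta>\<close>.\<close>

lemma hausdorff_measure_eq_0_iff:
  assumes "0 < s"
  shows "hausdorff_measure s E = 0 \<longleftrightarrow> hausdorff_null s E"
proof
  assume "hausdorff_measure s E = 0"
  then have *: "hausdorff_content s 1 E = 0"
    by (rule hausdorff_content_eq_0_if_measure_eq_0) simp
  show "hausdorff_null s E"
    unfolding hausdorff_null_def
  proof (intro allI impI)
    fix \<epsilon> :: real assume "0 < \<epsilon>"
    then have "hausdorff_content s 1 E < ennreal \<epsilon>" using * by simp
    then show "\<exists>U :: nat \<Rightarrow> real set. E \<subseteq> (\<Union>i. U i) \<and> (\<forall>i. bounded (U i)) \<and>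
     (\<Sum>i. ennreal (diameter (U i) powr s)) < ennreal \<epsilon>"
      unfolding hausdorff_content_def INF_less_iff cover_term_pos[OF assms] by blast
  qed
next
  assume null: "hausdorff_null s E"
  have "hausdorff_content s \<delta> E \<le> ennreal \<epsilon>" if "0 < \<delta>" "0 < \<epsilon>" for \<delta> \<epsilon>
  proof -
    have "0 < min \<epsilon> (\<delta> powr s)" using that by simp
    then obtain U :: "nat \<Rightarrow> real set" where U: "E \<subseteq> (\<Union>i. U i)" "\<forall>i. bounded (U i)"
      "(\<Sum>i. ennreal (diameter (U i) powr s)) < ennreal (min \<epsilon> (\<delta> powr s))"
      using null unfolding hausdorff_null_def by blast
    have "diameter (U i) \<le> \<delta>" for i
    proof -
      have "ennreal (diameter (U i) powr s) < ennreal (min \<epsilon> (\<delta> powr s))"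
        using diameter_powr_le_suminf U(3) by (rule le_less_trans)
      then have "diameter (U i) powr s < \<delta> powr s"
        by (simp add: ennreal_less_iff)
      then show ?thesis
        using powr_mono2[of s \<delta> "diameter (U i)"] assms that by fastforce
    qed
    then have "hausdorff_content s \<delta> E \<le> (\<Sum>i. cover_term s (U i))"
      unfolding hausdorff_content_def using U by (intro INF_lower) auto
    also have "\<dots> \<le> ennreal \<epsilon>"
      using U(3) unfolding cover_term_pos[OF assms]
      by (meson ennreal_leI less_imp_le min.cobounded1 order_trans)
    finally show ?thesis .
  qed
  then have "hausdorff_content s \<delta> E = 0" if "0 < \<delta>" for \<delta>
    using that ennreal_le_epsilon[of 0 "hausdorff_content s \<delta> E"] by simp
  then show "hausdorff_measure s E = 0"
    unfolding hausdorff_measure_def by simp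
qed

lemma hausdorff_null_subset: "hausdorff_null s E \<Longrightarrow> A \<subseteq> E \<Longrightarrow> hausdorff_null s A"
  unfolding hausdorff_null_def by (meson subset_trans)

text \<open>A sum below 1 forces all diameters to be at most 1, where a larger exponent only shrinks
  the terms; hence the bound \<open>min \<epsilon> 1\<close>.\<close>

lemma hausdorff_null_exponent_mono:
  assumes "hausdorff_null t E" "0 < t" "t \<le> s"
  shows "hausdorff_null s E"
  unfolding hausdorff_null_def
proof (intro allI impI)
  fix \<epsilon> :: real assume "0 < \<epsilon>"
  then have "0 < min \<epsilon> 1" by simp
  then obtain U :: "nat \<Rightarrow> real set" where U: "E \<subseteq> (\<Union>i. U i)" "\<forall>i. bounded (U i)"
    "(\<Sum>i. ennreal (diameter (U i) powr t)) < ennreal (min \<epsilon> 1)"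
    using assms(1) unfolding hausdorff_null_def by blast
  have "diameter (U i) powr s \<le> diameter (U i) powr t" for i
  proof -
    have "ennreal (diameter (U i) powr t) < ennreal (min \<epsilon> 1)"
      using diameter_powr_le_suminf U(3) by (rule le_less_trans)
    then have "diameter (U i) powr t < 1"
      by (simp add: ennreal_less_iff)
    then have "diameter (U i) \<le> 1"
      using powr_mono2[of t 1 "diameter (U i)"] assms by fastforce
    then show ?thesis
      using diameter_ge_0[of "U i"] U(2) assms by (intro powr_mono') auto
  qed
  then have "(\<Sum>i. ennreal (diameter (U i) powr s)) \<le> (\<Sum>i. ennreal (diameter (U i) powr t))"
    by (intro suminf_le) (auto intro: ennreal_leI)
  also have "\<dots> < ennreal \<epsilon>" using U(3) \<open>0 < \<epsilon>\<close>
    by (metis ennreal_leI less_le_trans min.cobounded1)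
  finally show "\<exists>U :: nat \<Rightarrow> real set. E \<subseteq> (\<Union>i. U i) \<and> (\<forall>i. bounded (U i)) \<and>
     (\<Sum>i. ennreal (diameter (U i) powr s)) < ennreal \<epsilon>"
    using U by blast
qed

lemma hausdorff_null_UN:
  assumes "\<And>k :: nat. hausdorff_null s (E k)"
  shows "hausdorff_null s (\<Union>k. E k)"
  unfolding hausdorff_null_def
proof (intro allI impI)
  fix \<epsilon> :: real assume "0 < \<epsilon>"
  \<comment> \<open>The additional factor 1/2 leaves room for the strict inequality, since summing
    the strict bounds yields only \<open>\<le>\<close>.\<close>
  have "\<exists>U :: nat \<Rightarrow> real set. E k \<subseteq> (\<Union>i. U i) \<and> (\<forall>i. bounded (U i)) \<and>
     (\<Sum>i. ennreal (diameter (U i) powr s)) < ennreal (\<epsilon>/2 * (1/2)^Suc k)" for k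
    using assms[of k] \<open>0 < \<epsilon>\<close> unfolding hausdorff_null_def by simp
  then obtain U :: "nat \<Rightarrow> nat \<Rightarrow> real set" where U: "\<And>k. E k \<subseteq> (\<Union>i. U k i)" "\<And>k i. bounded (U k i)"
     "\<And>k. (\<Sum>i. ennreal (diameter (U k i) powr s)) < ennreal (\<epsilon>/2 * (1/2)^Suc k)"
    by metis
  define V where "V = (\<lambda>j. case prod_decode j of (k, i) \<Rightarrow> U k i)"
  have V: "V (prod_encode (k, i)) = U k i" for k i
    by (simp add: V_def)
  have "(\<Union>k. E k) \<subseteq> (\<Union>j. V j)"
  proof
    fix x assume "x \<in> (\<Union>k. E k)"
    then obtain k i where "x \<in> U k i" using U(1) by blast
    then show "x \<in> (\<Union>j. V j)" using V by blast
  qed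
  moreover have "bounded (V j)" for j
    unfolding V_def using U(2) by (auto split: prod.split)
  moreover have "(\<Sum>j. ennreal (diameter (V j) powr s)) < ennreal \<epsilon>"
  proof -
    have "(\<Sum>j. ennreal (diameter (V j) powr s)) =
        (\<Sum>j. (\<lambda>(k, i). ennreal (diameter (U k i) powr s)) (prod_decode j))"
      by (simp add: V_def case_prod_unfold)
    also have "\<dots> = (\<Sum>k. (\<Sum>i. ennreal (diameter (U k i) powr s)))"
      by (rule suminf_ennreal_2dimen) simp
    also have "\<dots> \<le> (\<Sum>k. ennreal (\<epsilon>/2 * (1/2)^Suc k))"
      by (intro suminf_le less_imp_le U(3)) auto
    also have "\<dots> = ennreal (\<epsilon>/2)"
      using sums_mult[OF power_half_series, of "\<epsilon>/2"] \<open>0 < \<epsilon>\<close>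
      by (intro suminf_ennreal_eq) auto
    also have "\<dots> < ennreal \<epsilon>" using \<open>0 < \<epsilon>\<close> by (simp add: ennreal_less_iff)
    finally show ?thesis .
  qed
  ultimately show "\<exists>U :: nat \<Rightarrow> real set. (\<Union>k. E k) \<subseteq> (\<Union>i. U i) \<and> (\<forall>i. bounded (U i)) \<and>
     (\<Sum>i. ennreal (diameter (U i) powr s)) < ennreal \<epsilon>" by blast
qed

lemma hausdorff_null_Un:
  assumes "hausdorff_null s A" "hausdorff_null s B"
  shows "hausdorff_null s (A \<union> B)"
proof -
  have "hausdorff_null s (\<Union>k :: nat. if k = 0 then A else B)"
    using assms by (intro hausdorff_null_UN) auto
  moreover have "A \<union> B = (\<Union>k :: nat. if k = 0 then A else B)"
    by (auto split: if_splits)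
  ultimately show ?thesis by simp
qed

text \<open>A cover of the image is pulled back: points of \<open>E\<close> with images in the same
  \<open>U i\<close> are at distance at most \<open>C * diameter (U i) powr \<gamma>\<close>, so the
  exponent \<open>\<gamma> * s\<close> on the image side becomes \<open>s\<close>.\<close>

lemma hausdorff_null_inverse_Holder:
  fixes f :: "real \<Rightarrow> real"
  assumes null: "hausdorff_null (\<gamma> * s) E'" and f: "f ` E \<subseteq> E'" and s: "0 < s" "0 < \<gamma>" and C: "0 < C"
    and dist: "\<And>x y. x \<in> E \<Longrightarrow> y \<in> E \<Longrightarrow> \<bar>x - y\<bar> \<le> C * \<bar>f x - f y\<bar> powr \<gamma>"
  shows "hausdorff_null s E"
  unfolding hausdorff_null_def
proof (intro allI impI)
  fix \<epsilon> :: real assume "0 < \<epsilon>"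
  then have "0 < \<epsilon> / C powr s" using C by simp
  then obtain U :: "nat \<Rightarrow> real set" where U: "E' \<subseteq> (\<Union>i. U i)" "\<forall>i. bounded (U i)"
    "(\<Sum>i. ennreal (diameter (U i) powr (\<gamma> * s))) < ennreal (\<epsilon> / C powr s)"
    using null unfolding hausdorff_null_def by blast
  define V where "V i = E \<inter> f -` U i" for i
  have d: "\<bar>x - y\<bar> \<le> C * diameter (U i) powr \<gamma>" if "x \<in> V i" "y \<in> V i" for x y i
  proof -
    have "\<bar>f x - f y\<bar> \<le> diameter (U i)"
      using diameter_bounded_bound[of "U i" "f x" "f y"] U(2) that by (auto simp: V_def dist_real_def)
    then have "\<bar>f x - f y\<bar> powr \<gamma> \<le> diameter (U i) powr \<gamma>"
      using s by (intro powr_mono2) auto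
    then show ?thesis
      using dist[of x y] that C by (auto simp: V_def intro: order_trans mult_left_mono)
  qed
  have b: "bounded (V i)" for i
  proof (cases "V i = {}")
    case False
    then obtain x where "x \<in> V i" by blast
    then show ?thesis using d[of x i] unfolding bounded_def dist_real_def by blast
  qed simp
  have "diameter (V i) \<le> C * diameter (U i) powr \<gamma>" for i
    using d C by (intro diameter_le) auto
  then have "diameter (V i) powr s \<le> (C * diameter (U i) powr \<gamma>) powr s" for i
    using diameter_ge_0[OF b] s by (intro powr_mono2) auto
  then have le: "diameter (V i) powr s \<le> C powr s * diameter (U i) powr (\<gamma> * s)" for i
    using C by (simp add: powr_mult powr_powr)
  have "(\<Sum>i. ennreal (diameter (V i) powr s)) \<le> (\<Sum>i. ennreal (C powr s) * ennreal (diameter (U i) powr (\<gamma> * s)))"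
    using le by (intro suminf_le) (auto intro!: ennreal_leI simp flip: ennreal_mult')
  also have "\<dots> = ennreal (C powr s) * (\<Sum>i. ennreal (diameter (U i) powr (\<gamma> * s)))"
    by simp
  also have "\<dots> < ennreal (C powr s) * ennreal (\<epsilon> / C powr s)"
    using U(3) C by (intro ennreal_mult_strict_left_mono) auto
  also have "\<dots> = ennreal \<epsilon>"
    using C \<open>0 < \<epsilon>\<close> by (simp flip: ennreal_mult')
  finally have "(\<Sum>i. ennreal (diameter (V i) powr s)) < ennreal \<epsilon>" .
  moreover have "E \<subseteq> (\<Union>i. V i)" using U(1) f by (fastforce simp: V_def)
  ultimately show "\<exists>U :: nat \<Rightarrow> real set. E \<subseteq> (\<Union>i. U i) \<and> (\<forall>i. bounded (U i)) \<and>
     (\<Sum>i. ennreal (diameter (U i) powr s)) < ennreal \<epsilon>" using b by blast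
qed

text \<open>Supplies an element of the set whose infimum is \<open>hausdorff_dim\<close>. With
  exponent 2, \<open>N\<close> intervals of length \<open>1 / N\<close> have total
  \<open>1 / N\<close>, whereas exponent 1 would give 1.\<close>

lemma hausdorff_null_2_unit_interval: "hausdorff_null 2 {0..1}"
  unfolding hausdorff_null_def
proof (intro allI impI)
  fix \<epsilon> :: real assume "0 < \<epsilon>"
  then obtain n :: nat where n: "1 / real (Suc n) < \<epsilon>" using nat_approx_posE by blast
  define N where "N = Suc n"
  define U where "U i = (if i < N then {real i / N .. (real i + 1) / N} else {})" for i
  have dU: "diameter (U i) = (if i < N then 1 / N else 0)" for i
    by (auto simp: U_def N_def field_simps diameter_closed_interval)
  have "{0..1} \<subseteq> (\<Union>i. U i)"
  proof
    fix x :: real assume x: "x \<in> {0..1}"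
    show "x \<in> (\<Union>i. U i)"
    proof (cases "x = 1")
      case True
      then have "x \<in> U n" by (auto simp: U_def N_def)
      then show ?thesis by blast
    next
      case False
      define i where "i = nat \<lfloor>x * N\<rfloor>"
      have "0 \<le> x * N" using x by simp
      then have "real i = of_int \<lfloor>x * N\<rfloor>" unfolding i_def by (metis of_nat_nat zero_le_floor)
      then have i: "real i \<le> x * N" "x * N < real i + 1" by linarith+
      have "x * N < N" using False x by (simp add: N_def)
      then have "i < N" using i by linarith
      then have "x \<in> U i" using i x by (auto simp: U_def N_def field_simps)
      then show ?thesis by blast
    qed
  qed
  moreover have "bounded (U i)" for i by (simp add: U_def)
  moreover have "(\<Sum>i. ennreal (diameter (U i) powr 2)) < ennreal \<epsilon>"
  proof -
    have "(\<Sum>i. ennreal (diameter (U i) powr 2)) = (\<Sum>i<N. ennreal (diameter (U i) powr 2))"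
      by (intro suminf_finite) (auto simp: dU)
    also have "\<dots> = ennreal (\<Sum>i<N. diameter (U i) powr 2)"
      by (simp)
    also have "(\<Sum>i<N. diameter (U i) powr 2) = (\<Sum>i<N. (1 / real N)^2)"
      by (intro sum.cong) (auto simp: dU powr_realpow')
    also have "\<dots> = 1 / N" by (simp add: power2_eq_square N_def)
    also have "ennreal \<dots> < ennreal \<epsilon>"
      using n \<open>0 < \<epsilon>\<close> by (simp add: N_def ennreal_less_iff)
    finally show ?thesis .
  qed
  ultimately show "\<exists>U :: nat \<Rightarrow> real set. {0..1} \<subseteq> (\<Union>i. U i) \<and> (\<forall>i. bounded (U i)) \<and>
     (\<Sum>i. ennreal (diameter (U i) powr 2)) < ennreal \<epsilon>" by blast
qed

text \<open>At exponent 0 every nonempty covering set counts 1, so a total below 1 leaves only empty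
  sets. The case is separate because the infimum in \<open>hausdorff_dim\<close> also ranges over
  0.\<close>

lemma hausdorff_measure_0_imp_empty:
  assumes "hausdorff_measure 0 E = 0"
  shows "E = {}"
proof -
  have "hausdorff_content 0 1 E < 1"
    using hausdorff_content_eq_0_if_measure_eq_0[OF assms, of 1] by simp
  then obtain U :: "nat \<Rightarrow> real set" where U: "E \<subseteq> (\<Union>i. U i)" "(\<Sum>i. cover_term 0 (U i)) < 1"
    unfolding hausdorff_content_def INF_less_iff by blast
  have "cover_term 0 (U i) < 1" for i
    using sum_le_suminf[of "\<lambda>i. cover_term 0 (U i)" "{i}"] U(2) by (simp add: le_less_trans)
  then have "U i = {}" for i by (metis cover_term_def less_irrefl)
  then show ?thesis using U(1) by simp
qed

lemma hausdorff_dim_le: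
  "hausdorff_null s E \<Longrightarrow> 0 < s \<Longrightarrow> hausdorff_dim E \<le> s"
  unfolding hausdorff_dim_def
  by (intro cInf_lower) (auto simp: hausdorff_measure_eq_0_iff intro: bdd_belowI[of _ 0])

lemma hausdorff_null_empty: "0 < s \<Longrightarrow> hausdorff_null s {}"
  unfolding hausdorff_null_def by (auto intro!: exI[of _ "\<lambda>_. {}"])

lemma hausdorff_measure_2_eq_0: "E \<subseteq> {0..1} \<Longrightarrow> hausdorff_measure 2 E = 0"
  by (simp add: hausdorff_measure_eq_0_iff hausdorff_null_subset[OF hausdorff_null_2_unit_interval])

lemma hausdorff_dim_nonneg: "E \<subseteq> {0..1} \<Longrightarrow> 0 \<le> hausdorff_dim E"
  unfolding hausdorff_dim_def using hausdorff_measure_2_eq_0[of E]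
  by (intro cInf_greatest) (auto intro: exI[of _ 2])

lemma hausdorff_null_if_dim_less:
  assumes "E \<subseteq> {0..1}" "hausdorff_dim E < s"
  shows "hausdorff_null s E"
proof -
  obtain r where r: "0 \<le> r" "hausdorff_measure r E = 0" "r < s"
    using cInf_lessD[of "{s. 0 \<le> s \<and> hausdorff_measure s E = 0}" s] assms
      hausdorff_measure_2_eq_0[OF assms(1)] unfolding hausdorff_dim_def by fastforce
  show ?thesis
  proof (cases "r = 0")
    case True
    then show ?thesis using r hausdorff_measure_0_imp_empty hausdorff_null_empty by auto
  next
    case False
    then show ?thesis using r hausdorff_measure_eq_0_iff hausdorff_null_exponent_mono by auto
  qed
qed

lemma hausdorff_dim_mono:
  assumes "A \<subseteq> E" "E \<subseteq> {0..1}"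
  shows "hausdorff_dim A \<le> hausdorff_dim E"
proof (rule dense_ge)
  fix s assume "hausdorff_dim E < s"
  moreover have "0 \<le> hausdorff_dim E" using assms(2) by (rule hausdorff_dim_nonneg)
  ultimately show "hausdorff_dim A \<le> s"
    using assms by (intro hausdorff_dim_le hausdorff_null_subset[OF hausdorff_null_if_dim_less[of E]]) auto
qed

section \<open>Continuants of backward continued fractions\<close>

fun cstep :: "int \<times> int \<Rightarrow> int \<Rightarrow> int \<times> int" where
  "cstep (q, q') b = (q * b - q', q)"


text \<open>The digits \<open>w = [b\<^sub>1, \<dots>, b\<^sub>n]\<close> and the tail \<open>t\<close> determine the point
  \<open>(num w * t - num' w) / (den w * t - den' w)\<close> of \<open>(0, 1)\<close>; for \<open>w = []\<close> it is \<open>1 - 1 / t\<close>.\<close>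

definition den :: "int list \<Rightarrow> int" where "den w = fst (foldl cstep (1, 0) w)"
definition den' :: "int list \<Rightarrow> int" where "den' w = snd (foldl cstep (1, 0) w)"
definition num :: "int list \<Rightarrow> int" where "num w = fst (foldl cstep (1, 1) w)"
definition num' :: "int list \<Rightarrow> int" where "num' w = snd (foldl cstep (1, 1) w)"

lemma continuant_Nil [simp]: "den [] = 1" "den' [] = 0" "num [] = 1" "num' [] = 1"
  by (simp_all add: den_def den'_def num_def num'_def)

lemma continuant_snoc [simp]:
  "den (w @ [b]) = den w * b - den' w" "den' (w @ [b]) = den w"
  "num (w @ [b]) = num w * b - num' w" "num' (w @ [b]) = num w"
  by (cases "foldl cstep (1, 0) w"; cases "foldl cstep (1, 1) w";
      simp add: den_def den'_def num_def num'_def)+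

lemma continuant_single [simp]: "den [b] = b" "den' [b] = 1" "num [b] = b - 1" "num' [b] = 1"
  using continuant_snoc[of "[]" b] by simp_all

text \<open>Each digit acts on both pairs by one matrix of determinant 1, and the starting pairs
  \<open>(1, 0)\<close> and \<open>(1, 1)\<close> give the value 1.\<close>

lemma continuant_det: "num' w * den w - num w * den' w = 1"
  by (induction w rule: rev_induct) (auto simp: algebra_simps)

text \<open>\<open>cstep\<close> is linear in the pair, and \<open>(den w, den' w)\<close> is
  \<open>den w - den' w\<close> times \<open>(1, 0)\<close> plus \<open>den' w\<close> times
  \<open>(1, 1)\<close>, the starting pairs of \<open>den\<close> and \<open>num\<close>.\<close>

lemma den_append: "den (w @ v) = (den w - den' w) * den v + den' w * num v"
proof -
  have "den (w @ v) = (den w - den' w) * den v + den' w * num v \<and>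
    den' (w @ v) = (den w - den' w) * den' v + den' w * num' v"
  proof (induction v rule: rev_induct)
    case (snoc b v)
    then show ?case by (simp flip: append_assoc) (simp add: algebra_simps)
  qed (simp add: algebra_simps)
  then show ?thesis by simp
qed

abbreviation digits_ge2 :: "int list \<Rightarrow> bool" where
  "digits_ge2 w \<equiv> \<forall>b\<in>set w. 2 \<le> b"

text \<open>For \<open>b \<ge> 2\<close> the increment \<open>den w * b - den' w - den w\<close> is
  at least \<open>den w - den' w\<close>, so the increments never fall below their initial value 1.
  Runs of 2s attain the linear bound.\<close>

lemma den_bounds:
  assumes "digits_ge2 w"
  shows "0 \<le> den' w" "1 \<le> den w - den' w" "int (length w) + 1 \<le> den w"
proof -
  have "0 \<le> den' w \<and> 1 \<le> den w - den' w \<and> int (length w) + 1 \<le> den w"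
    using assms
  proof (induction w rule: rev_induct)
    case (snoc b w)
    then have IH: "0 \<le> den' w" "1 \<le> den w - den' w" "int (length w) + 1 \<le> den w" and b: "2 \<le> b" by auto
    have "den w * 2 \<le> den w * b" using b IH by (intro mult_left_mono) auto
    then show ?case using IH
      by (simp only: continuant_snoc length_append_singleton of_nat_Suc) (intro conjI; linarith)
  qed simp
  then show "0 \<le> den' w" "1 \<le> den w - den' w" "int (length w) + 1 \<le> den w" by auto
qed

lemma num_bounds:
  assumes "digits_ge2 w"
  shows "0 \<le> num w" "num w \<le> den w"
proof -
  \<comment> \<open>The empty word is an exception: there \<open>num' w = 1\<close> exceeds
    \<open>den' w = 0\<close>.\<close>
  have "0 \<le> num' w \<and> num' w \<le> num w \<and>
     (if w = [] then num w = den w else num w \<le> den w \<and> num' w \<le> den' w \<and> num w - num' w \<le> den w - den' w)"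
    using assms
  proof (induction w rule: rev_induct)
    case (snoc b w)
    have b: "2 \<le> b" using snoc by auto
    note w = den_bounds[of w]
    show ?case
    proof (cases "w = []")
      case True
      then show ?thesis using b by simp
    next
      case False
      then have IH: "0 \<le> num' w" "num' w \<le> num w" "num w \<le> den w" "num' w \<le> den' w"
        "num w - num' w \<le> den w - den' w" using snoc by auto
      have "num w * 2 \<le> num w * b" using b IH by (intro mult_left_mono) auto
      then have "num w + num w \<le> num w * b" by linarith
      moreover have "(den w - num w) * 2 \<le> (den w - num w) * b" using b IH by (intro mult_left_mono) auto
      then have "(den w - num w) + (den w - num w) \<le> den w * b - num w * b" by (simp add: algebra_simps)
      ultimately show ?thesis using IH by (auto simp: algebra_simps)
    qed
  qed simp
  then show "0 \<le> num w" "num w \<le> den w" by (auto split: if_splits)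
qed

lemma den_append_le:
  assumes "digits_ge2 w" "digits_ge2 v"
  shows "den (w @ v) \<le> den w * den v"
proof -
  have "den' w * num v \<le> den' w * den v"
    using den_bounds[OF assms(1)] num_bounds[OF assms(2)] by (intro mult_left_mono) auto
  then show ?thesis by (simp add: den_append algebra_simps)
qed

text \<open>Discards the term with \<open>num v\<close>, which stays 1 when \<open>v\<close> is a
  run of 2s. The loss from \<open>den w\<close> to \<open>den w - den' w\<close> is later repaired
  by bad approximability.\<close>

lemma den_append_ge:
  assumes "digits_ge2 w" "digits_ge2 v"
  shows "(den w - den' w) * den v \<le> den (w @ v)"
  using den_bounds[OF assms(1)] num_bounds[OF assms(2)] by (simp add: den_append)

lemma den_le_den_append:
  assumes "digits_ge2 w" "digits_ge2 v"
  shows "den v \<le> den (w @ v)"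
proof -
  have "1 * den v \<le> (den w - den' w) * den v"
    using den_bounds[OF assms(1)] den_bounds[OF assms(2)] by (intro mult_right_mono) auto
  then show ?thesis using den_append_ge[OF assms] by simp
qed

lemma den_replicate_2: "den (replicate r 2) = int r + 1"
proof -
  have "den (replicate r 2) = int r + 1 \<and> den' (replicate r 2) = int r"
    by (induction r) (auto simp flip: replicate_append_same)
  then show ?thesis by simp
qed

section \<open>Expansions and their tails\<close>

text \<open>A certificate that \<open>x\<close> in (0, 1) has digits \<open>b\<close> and tails
  \<open>t\<close>. As \<open>b_0(x) = 1\<close> is fixed, \<open>b n\<close> is the digit with
  index \<open>n + 1\<close>. The strict bound \<open>1 < t n\<close> excludes expansions ending in
  2s.\<close>

definition bcf_expansion :: "real \<Rightarrow> (nat \<Rightarrow> int) \<Rightarrow> (nat \<Rightarrow> real) \<Rightarrow> bool" where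
  "bcf_expansion x b t \<longleftrightarrow> x = 1 - 1 / t 0 \<and> (\<forall>n. 1 < t n \<and> t n = b n - 1 / t (Suc n))"

abbreviation prefix :: "(nat \<Rightarrow> int) \<Rightarrow> nat \<Rightarrow> int list" where
  "prefix b n \<equiv> map b [0..<n]"

lemma bcf_expansionD:
  fixes t :: "nat \<Rightarrow> real"
  assumes "bcf_expansion x b t"
  shows "x = 1 - 1 / t 0" "1 < t n" "t n = b n - 1 / t (Suc n)" "real_of_int (b n) - 1 < t n" "t n < b n" "2 \<le> b n"
proof -
  show t: "1 < t n" "t n = b n - 1 / t (Suc n)"
    using assms unfolding bcf_expansion_def by blast+
  show "x = 1 - 1 / t 0" using assms unfolding bcf_expansion_def by blast
  have "1 < t (Suc n)" using assms unfolding bcf_expansion_def by blast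
  then have "0 < 1 / t (Suc n)" "1 / t (Suc n) < 1" by (auto simp: field_simps)
  then show "real_of_int (b n) - 1 < t n" "t n < b n" using t by linarith+
  then show "2 \<le> b n" using t by linarith
qed

lemma digits_ge2_prefix: "bcf_expansion x b t \<Longrightarrow> digits_ge2 (prefix b n)"
  by (auto intro: bcf_expansionD(6))

lemma mobius_den_pos:
  fixes t :: real
  assumes "digits_ge2 w" "1 < t"
  shows "den w - den' w \<le> den w * t - den' w" "0 < den w * t - den' w"
proof -
  have "of_int (den w) * 1 \<le> of_int (den w) * t"
    using den_bounds[OF assms(1)] assms by (intro mult_left_mono) auto
  then show "den w - den' w \<le> den w * t - den' w" by simp
  moreover have "1 \<le> real_of_int (den w - den' w)" using den_bounds[OF assms(1)] by linarith
  ultimately show "0 < den w * t - den' w" by linarith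
qed

lemma bcf_expansion_mobius:
  fixes t :: "nat \<Rightarrow> real"
  assumes "bcf_expansion x b t"
  defines "w \<equiv> \<lambda>n. prefix b n"
  shows "x = (num (w n) * t n - num' (w n)) / (den (w n) * t n - den' (w n))"
proof -
  have pos: "0 < den (w n) * t n - den' (w n)" for n
    using mobius_den_pos(2)[OF digits_ge2_prefix[OF assms(1)] bcf_expansionD(2)[OF assms(1)]]
    by (simp add: w_def)
  have "x * (den (w n) * t n - den' (w n)) = num (w n) * t n - num' (w n)" for n
  proof (induction n)
    case 0
    show ?case using bcf_expansionD(1)[OF assms(1)] bcf_expansionD(2)[OF assms(1), of 0] by (simp add: w_def field_simps)
  next
    case (Suc n)
    have t: "0 < t (Suc n)" "b n = t n + 1 / t (Suc n)"
      using bcf_expansionD(2)[OF assms(1), of "Suc n"] bcf_expansionD(3)[OF assms(1), of n] by auto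
    have bt: "b n * t (Suc n) = t n * t (Suc n) + 1"
      using t by (simp add: field_simps)
    have "den (w (Suc n)) * t (Suc n) - den' (w (Suc n)) = (den (w n) * t n - den' (w n)) * t (Suc n)"
      "num (w (Suc n)) * t (Suc n) - num' (w (Suc n)) = (num (w n) * t n - num' (w n)) * t (Suc n)"
      using bt by (simp_all add: w_def left_diff_distrib mult.assoc) (simp_all add: algebra_simps)
    then show ?case using Suc by (metis mult.assoc)
  qed
  then show ?thesis using pos[of n] by (simp add: field_simps)
qed

lemma mobius_diff:
  fixes t s :: real
  assumes "digits_ge2 w" "1 < t" "1 < s"
  shows "(num w * t - num' w) / (den w * t - den' w) - (num w * s - num' w) / (den w * s - den' w)
     = (t - s) / ((den w * t - den' w) * (den w * s - den' w))"
proof -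
  have "real_of_int (num' w * den w - num w * den' w) = 1"
    by (simp only: continuant_det)
  then have det: "num' w * den w - num w * den' w = (1 :: real)" by simp
  have "(num w * t - num' w) * (den w * s - den' w) - (num w * s - num' w) * (den w * t - den' w)
     = (t - s) * (num' w * den w - num w * den' w)" by (simp add: algebra_simps)
  then show ?thesis
    using mobius_den_pos(2)[OF assms(1,2)] mobius_den_pos(2)[OF assms(1,3)] det
    by (simp add: diff_frac_eq)
qed

text \<open>The tail 1 is the expansion with all digits 2, so the subtracted fraction is the
  rational number obtained by continuing \<open>w\<close> with 2s forever; long runs of 2s pull a
  point towards it.\<close>

lemma mobius_diff_1:
  fixes t :: real
  assumes "digits_ge2 w" "1 < t"
  shows "(num w * t - num' w) / (den w * t - den' w) - (num w - num' w) / (den w - den' w)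
     = (t - 1) / ((den w * t - den' w) * (den w - den' w))"
proof -
  have "real_of_int (num' w * den w - num w * den' w) = 1"
    by (simp only: continuant_det)
  then have det: "num' w * den w - num w * den' w = (1 :: real)" by simp
  have "(num w * t - num' w) * (den w - den' w) - (num w - num' w) * (den w * t - den' w)
     = (t - 1) * (num' w * den w - num w * den' w)" by (simp add: algebra_simps)
  moreover have "real_of_int (den w - den' w) \<ge> 1" using den_bounds[OF assms(1)] by linarith
  ultimately show ?thesis
    using mobius_den_pos(2)[OF assms] det by (simp add: diff_frac_eq)
qed

lemma coprime_continuant_diff: "coprime (num w - num' w) (den w - den' w)"
proof (rule coprimeI)
  fix c assume "c dvd num w - num' w" "c dvd den w - den' w"
  then have "c dvd (den w - den' w) * num w - (num w - num' w) * den w"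
    by simp
  also have "(den w - den' w) * num w - (num w - num' w) * den w = 1"
    using continuant_det[of w] by (simp add: algebra_simps)
  finally show "is_unit c" .
qed

lemma bcf_expansion_0_1: "bcf_expansion x b t \<Longrightarrow> 0 < x \<and> x < 1"
  using bcf_expansionD(1)[of x b t] bcf_expansionD(2)[of x b t 0] by simp

lemma bcf_expansion_shift: "bcf_expansion x b t \<Longrightarrow> (bcf_shift ^^ Suc n) x = t n"
proof (induction n)
  case 0
  then have "\<lfloor>x\<rfloor> = 0" using bcf_expansion_0_1[of x b t] by (simp add: floor_eq_iff)
  moreover have "x = 1 - 1 / t 0" using 0 by (rule bcf_expansionD)
  ultimately show ?case by (simp add: bcf_shift_def bcf_b0_def)
next
  case (Suc n)
  have "\<lfloor>t n\<rfloor> = b n - 1" using bcf_expansionD(4,5)[OF Suc.prems, of n] by (intro floor_unique) auto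
  then have "bcf_shift (t n) = t (Suc n)"
    using bcf_expansionD(3)[OF Suc.prems, of n] by (simp add: bcf_shift_def bcf_b0_def)
  then show ?case using Suc by simp
qed

lemma bcf_expansion_digit: "bcf_expansion x b t \<Longrightarrow> bcf_digit (Suc n) x = b n"
  unfolding bcf_digit_def bcf_expansion_shift bcf_b0_def
  using bcf_expansionD(4,5)[of x b t n] floor_unique[of "b n - 1" "t n"] by simp

text \<open>Descent on the denominator: \<open>t n = p / q\<close> gives
  \<open>t (Suc n) = q / r\<close> with \<open>r = b n * q - p\<close>, and
  \<open>b n - 1 < t n < b n\<close> puts \<open>r\<close> strictly between 0 and
  \<open>q\<close>.\<close>

lemma bcf_expansion_irrational:
  fixes t :: "nat \<Rightarrow> real"
  assumes "bcf_expansion x b t"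
  shows "x \<notin> \<rat>"
proof
  assume "x \<in> \<rat>"
  moreover have t0: "t 0 = 1 / (1 - x)" using bcf_expansionD(1)[OF assms] bcf_expansionD(2)[OF assms, of 0]
    by simp
  ultimately have "t 0 \<in> \<rat>" by simp
  have no: "\<not> (t n = real p / real q)" if "0 < q" for p q n
    using that
  proof (induction q arbitrary: p n rule: less_induct)
    case (less q)
    show ?case
    proof
      assume t: "t n = real p / real q"
      have b: "real_of_int (b n) - 1 < t n" "t n < b n" and Suc: "t n = b n - 1 / t (Suc n)" "1 < t (Suc n)"
        using bcf_expansionD[OF assms] by blast+
      define r where "r = nat (b n * int q - int p)"
      have "real_of_int (b n * int q - int p) = (b n - t n) * q"
        using less.prems by (simp add: t field_simps)
      moreover have "0 < (b n - t n) * q" "(b n - t n) * q < 1 * q"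
        using b less.prems by (auto intro!: mult_strict_right_mono simp del: mult_1)
      ultimately have "0 < b n * int q - int p" "b n * int q - int p < int q" by linarith+
      then have r: "0 < r" "r < q" "real r = b n * q - p" by (auto simp: r_def)
      have "t (Suc n) = 1 / (b n - t n)" using Suc by simp
      also have "b n - t n = real r / q" using r less.prems by (simp add: t field_simps)
      finally have "t (Suc n) = real q / real r" by simp
      then show False using less.IH r by blast
    qed
  qed
  obtain p q :: nat where "q \<noteq> 0" "\<bar>t 0\<bar> = real p / real q"
    using Rats_abs_nat_div_natE[OF \<open>t 0 \<in> \<rat>\<close>] by metis
  then show False using no[of q 0 p] bcf_expansionD(2)[OF assms, of 0] by simp
qed

lemma F_set_iff: "x \<in> F_set B \<longleftrightarrow> (\<exists>b t. bcf_expansion x b t \<and> (\<forall>n. b n \<in> int ` B))"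
proof
  assume x: "x \<in> F_set B"
  define T where "T n = (bcf_shift ^^ n) x" for n
  define b where "b n = bcf_b0 (T (Suc n))" for n
  have shift: "1 < bcf_shift y \<and> bcf_shift y \<notin> \<rat> \<and> y = bcf_b0 y - 1 / bcf_shift y" if "y \<notin> \<rat>" for y
  proof -
    have "of_int \<lfloor>y\<rfloor> \<noteq> y" using that by (metis Rats_of_int)
    then have "0 < bcf_b0 y - y" "bcf_b0 y - y < 1" unfolding bcf_b0_def by linarith+
    moreover have "bcf_shift y \<notin> \<rat>"
    proof
      assume "bcf_shift y \<in> \<rat>"
      then have "bcf_b0 y - 1 / bcf_shift y \<in> \<rat>" by simp
      then show False using that by (simp add: bcf_shift_def)
    qed
    ultimately show ?thesis by (simp add: bcf_shift_def)
  qed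
  have irr: "T n \<notin> \<rat>" for n
    using x shift by (induction n) (auto simp: T_def F_set_def)
  have "bcf_b0 x = 1" using x by (simp add: F_set_def bcf_b0_def floor_eq_iff)
  have TS: "T (Suc n) = bcf_shift (T n)" for n by (simp add: T_def)
  have "x = 1 - 1 / T (Suc 0)"
    using shift[OF irr[of 0]] \<open>bcf_b0 x = 1\<close> unfolding TS by (simp add: T_def)
  moreover have "1 < T (Suc n)" "T (Suc n) = b n - 1 / T (Suc (Suc n))" for n
    using shift[OF irr[of n]] shift[OF irr[of "Suc n"]] unfolding b_def TS[symmetric] by blast+
  \<comment> \<open>The tails start at \<open>T 1\<close>, because \<open>T 0 = x\<close> lies in
    (0, 1) and carries the digit \<open>b_0(x) = 1\<close>.\<close>
  ultimately have "bcf_expansion x b (\<lambda>n. T (Suc n))"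
    unfolding bcf_expansion_def by blast
  moreover have "b n \<in> int ` B" for n
    using x by (auto simp: b_def T_def F_set_def bcf_digit_def simp del: funpow.simps)
  ultimately show "\<exists>b t. bcf_expansion x b t \<and> (\<forall>n. b n \<in> int ` B)" by blast
next
  assume "\<exists>b t. bcf_expansion x b t \<and> (\<forall>n. b n \<in> int ` B)"
  then obtain b t where bt: "bcf_expansion x b t" "\<And>n. b n \<in> int ` B" by blast
  have "bcf_digit n x \<in> int ` B" if "1 \<le> n" for n
    using that bt bcf_expansion_digit[OF bt(1)] by (metis Suc_le_D One_nat_def)
  then show "x \<in> F_set B"
    using bcf_expansion_0_1[OF bt(1)] bcf_expansion_irrational[OF bt(1)] by (simp add: F_set_def)
qed

text \<open>The tails are limits of finite truncations; infinitely many digits other than 2 keep them away from 1.\<close>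
lemma bcf_expansion_exists:
  assumes ge2: "\<And>n. 2 \<le> b n" and inf: "\<And>n. \<exists>m\<ge>n. b m \<noteq> 2"
  shows "\<exists>x t. bcf_expansion x b t"
proof -
  define T where "T m = ((\<lambda>f n. real_of_int (b n) - 1 / f (Suc n)) ^^ m) (\<lambda>n. real_of_int (b n))" for m
  have T0: "T 0 n = b n" and TS: "T (Suc m) n = b n - 1 / T m (Suc n)" for m n
    by (simp_all add: T_def)
  have ge1: "1 \<le> T m n" for m n
  proof (induction m arbitrary: n)
    case 0 show ?case using ge2[of n] by (simp add: T0)
  next
    case (Suc m)
    have "1 / T m (Suc n) \<le> 1" using Suc[of "Suc n"] by simp
    then show ?case using ge2[of n] by (simp add: TS)
  qed
  have dec: "T (Suc m) n \<le> T m n" for m n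
  proof (induction m arbitrary: n)
    case 0 show ?case using ge1[of 0 "Suc n"] by (simp add: TS T0)
  next
    case (Suc m)
    have "1 / T m (Suc n) \<le> 1 / T (Suc m) (Suc n)"
      using Suc[of "Suc n"] ge1[of "Suc m" "Suc n"] by (intro divide_left_mono) auto
    then show ?case by (simp add: TS)
  qed
  have "\<exists>L. (\<lambda>m. T m n) \<longlonglongrightarrow> L" for n
    using decseq_convergent[OF decseq_SucI[of "\<lambda>m. T m n", OF dec], of 1] ge1 by metis
  then obtain t where t: "\<And>n. (\<lambda>m. T m n) \<longlonglongrightarrow> t n" by metis
  have t1: "1 \<le> t n" for n using ge1 by (intro LIMSEQ_le_const[OF t]) auto
  have "(\<lambda>m. T (Suc m) n) \<longlonglongrightarrow> b n - 1 / t (Suc n)" for n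
    unfolding TS using t1[of "Suc n"] by (intro tendsto_intros t) auto
  then have eq: "t n = b n - 1 / t (Suc n)" for n
    using LIMSEQ_unique LIMSEQ_Suc[OF t] by blast
  \<comment> \<open>A tail equal to 1 forces the digit 2 and the next tail 1, hence only 2s from
    there on.\<close>
  have "t n \<noteq> 1" for n
  proof
    assume 1: "t n = 1"
    have step: "b m = 2 \<and> t (Suc m) = 1" if "t m = 1" for m
    proof -
      have "1 / t (Suc m) = b m - 1" using eq[of m] that by simp
      moreover have "1 / t (Suc m) \<le> 1" using t1[of "Suc m"] by simp
      ultimately have "b m = 2" using ge2[of m] by linarith
      then show ?thesis using \<open>1 / t (Suc m) = b m - 1\<close> by simp
    qed
    have "t m = 1" if "n \<le> m" for m
      using that by (induction rule: dec_induct) (auto simp: 1 step)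
    then show False using inf[of n] step by blast
  qed
  then have "1 < t n" for n using t1[of n] by (simp add: less_le)
  then have "bcf_expansion (1 - 1 / t 0) b t" using eq unfolding bcf_expansion_def by blast
  then show ?thesis by blast
qed

section \<open>Insertion of runs of 2s\<close>

text \<open>After the \<open>n\<close>-th digit, \<open>n \<in> S\<close>, a run of digits 2 is inserted; its length, just above the
  \<open>e\<close>-th power of the current denominator, produces one approximation of exponent \<open>2 + e\<close>. The digit
  \<open>\<beta> \<ge> 3\<close> that closes the run keeps the new expansion from ending in 2s, which would be rational.\<close>

definition run_length :: "real \<Rightarrow> int list \<Rightarrow> nat" where
  "run_length e u = nat \<lfloor>real_of_int (den u) powr e\<rfloor> + 1"

fun insert_runs :: "real \<Rightarrow> int \<Rightarrow> nat set \<Rightarrow> (nat \<Rightarrow> int) \<Rightarrow> nat \<Rightarrow> int list" where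
  "insert_runs e \<beta> S b 0 = []"
| "insert_runs e \<beta> S b (Suc n) = insert_runs e \<beta> S b n @ b n #
     (if Suc n \<in> S then replicate (run_length e (insert_runs e \<beta> S b n @ [b n])) 2 @ [\<beta>] else [])"

text \<open>The pointwise limit of the words: stage \<open>Suc i\<close> has more than
  \<open>i\<close> letters, and later stages only append.\<close>

definition inserted_seq :: "real \<Rightarrow> int \<Rightarrow> nat set \<Rightarrow> (nat \<Rightarrow> int) \<Rightarrow> nat \<Rightarrow> int" where
  "inserted_seq e \<beta> S b i = insert_runs e \<beta> S b (Suc i) ! i"

text \<open>A bound on the new denominators that is uniform in the digits and in \<open>S\<close>.
  The set \<open>S\<close> has to be sparse relative to denominators which themselves depend on
  \<open>S\<close>; this bound breaks the circle.\<close>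

primrec den_bound :: "real \<Rightarrow> int \<Rightarrow> nat \<Rightarrow> real" where
  "den_bound e M 0 = 1"
| "den_bound e M (Suc n) = 3 * real_of_int M * (den_bound e M n * M) powr (1 + e)"

lemma insert_runs_mono: "n \<le> m \<Longrightarrow> \<exists>v. insert_runs e \<beta> S b m = insert_runs e \<beta> S b n @ v"
  by (induction rule: dec_induct) auto

lemma length_insert_runs: "n \<le> length (insert_runs e \<beta> S b n)"
  by (induction n) auto

lemma inserted_seq_nth:
  assumes "i < length (insert_runs e \<beta> S b n)"
  shows "inserted_seq e \<beta> S b i = insert_runs e \<beta> S b n ! i"
proof -
  let ?W = "insert_runs e \<beta> S b"
  have i: "i < length (?W (Suc i))" using length_insert_runs[of "Suc i" e \<beta> S b] by linarith
  show ?thesis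
  proof (cases "n \<le> Suc i")
    case True
    then obtain v where "?W (Suc i) = ?W n @ v" using insert_runs_mono by blast
    then show ?thesis using assms by (simp add: inserted_seq_def nth_append del: insert_runs.simps)
  next
    case False
    then obtain v where "?W n = ?W (Suc i) @ v" using insert_runs_mono[of "Suc i" n] by (metis nat_le_linear)
    then show ?thesis using i by (simp add: inserted_seq_def nth_append del: insert_runs.simps)
  qed
qed

lemma prefix_inserted_seq:
  "insert_runs e \<beta> S b n = w @ v \<Longrightarrow> prefix (inserted_seq e \<beta> S b) (length w) = w"
  by (rule nth_equalityI) (auto simp: inserted_seq_nth[of _ e \<beta> S b n] nth_append)

lemma inserted_seq_append_nth:
  "insert_runs e \<beta> S b n = w @ v \<Longrightarrow> i < length v \<Longrightarrow> inserted_seq e \<beta> S b (length w + i) = v ! i"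
  by (simp add: inserted_seq_nth[of _ e \<beta> S b n])

lemma insert_runs_cong:
  "(\<And>i. i < n \<Longrightarrow> b i = d i) \<Longrightarrow> insert_runs e \<beta> S b n = insert_runs e \<beta> S d n"
  by (induction n) auto

lemma set_insert_runs: "set (insert_runs e \<beta> S b n) \<subseteq> range b \<union> {2, \<beta>}"
  by (induction n) auto

lemma inserted_seq_in: "inserted_seq e \<beta> S b i \<in> range b \<union> {2, \<beta>}"
proof -
  have "i < length (insert_runs e \<beta> S b (Suc i))" using length_insert_runs[of "Suc i" e \<beta> S b] by linarith
  then show ?thesis
    unfolding inserted_seq_def using set_insert_runs nth_mem by blast
qed

lemma inserted_seq_frequently:
  assumes "infinite S"
  shows "\<exists>m\<ge>n. inserted_seq e \<beta> S b m = \<beta>"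
proof -
  obtain k where "k \<in> S" "n < k" using assms by (meson infinite_nat_iff_unbounded)
  then obtain j where j: "Suc j \<in> S" "n \<le> j" by (metis less_Suc_eq_le gr0_implies_Suc less_nat_zero_code not_gr_zero)
  let ?u = "insert_runs e \<beta> S b j @ b j # replicate (run_length e (insert_runs e \<beta> S b j @ [b j])) 2"
  have "inserted_seq e \<beta> S b (length ?u + 0) = [\<beta>] ! 0"
    using j by (intro inserted_seq_append_nth[of e \<beta> S b "Suc j"]) auto
  moreover have "n \<le> length ?u" using length_insert_runs[of j e \<beta> S b] j by simp
  ultimately show ?thesis by auto
qed

lemma insert_runs_no_insertion:
  assumes "a \<le> n" "\<And>m. a < m \<Longrightarrow> m \<le> n \<Longrightarrow> m \<notin> S"
  shows "insert_runs e \<beta> S b n = insert_runs e \<beta> S b a @ map b [a..<n]"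
  using assms by (induction rule: dec_induct) auto

lemma last_insertion_exists:
  "\<exists>a\<le>n :: nat. (a = 0 \<or> a \<in> S) \<and> (\<forall>m. a < m \<and> m \<le> n \<longrightarrow> m \<notin> S)"
proof (induction n)
  case (Suc n)
  then obtain a where "a \<le> n" "a = 0 \<or> a \<in> S" "\<forall>m. a < m \<and> m \<le> n \<longrightarrow> m \<notin> S" by blast
  then show ?case
    by (cases "Suc n \<in> S") (auto simp: le_Suc_eq intro: exI[of _ "Suc n"] exI[of _ a])
qed simp

text \<open>With \<open>X = den u powr e \<ge> 1\<close>, rounding gives a length \<open>r\<close>
  with \<open>X \<le> r\<close> and \<open>r + 1 \<le> X + 2 \<le> 3 * X\<close>; this is the origin
  of the constant 3.\<close>

lemma run_length_bounds:
  assumes "digits_ge2 u" "0 < e"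
  shows "real_of_int (den u) powr e \<le> run_length e u" "real (run_length e u) + 1 \<le> 3 * real_of_int (den u) powr e"
proof -
  have "1 \<le> real_of_int (den u)" using den_bounds(3)[OF assms(1)] by linarith
  then have 1: "1 \<le> real_of_int (den u) powr e" using assms by (intro ge_one_powr_ge_zero) auto
  have r: "real (run_length e u) = of_int \<lfloor>real_of_int (den u) powr e\<rfloor> + 1"
    unfolding run_length_def by (simp add: of_nat_nat)
  show "real_of_int (den u) powr e \<le> run_length e u" "real (run_length e u) + 1 \<le> 3 * real_of_int (den u) powr e"
    unfolding r using 1 by linarith+
qed

text \<open>The denominator of a run is linear in its length, so a run of length about
  \<open>den u powr e\<close> costs only the power \<open>1 + e\<close>.\<close>

lemma den_append_run:
  assumes u: "digits_ge2 u" and "0 < e" and \<beta>: "2 \<le> \<beta>" "\<beta> \<le> M"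
  shows "den (u @ replicate (run_length e u) 2 @ [\<beta>]) \<le> 3 * real_of_int M * real_of_int (den u) powr (1 + e)"
proof -
  have "den (u @ replicate (run_length e u) 2 @ [\<beta>]) \<le> den u * den (replicate (run_length e u) 2 @ [\<beta>])"
    using u \<beta> by (intro den_append_le) auto
  also have "\<dots> \<le> den u * (den (replicate (run_length e u) 2) * den [\<beta>])"
    using den_bounds(3)[OF u] \<beta> by (intro mult_left_mono den_append_le) auto
  also have "\<dots> = den u * (int (run_length e u) + 1) * \<beta>" by (simp add: den_replicate_2)
  finally have "real_of_int (den (u @ replicate (run_length e u) 2 @ [\<beta>]))
      \<le> den u * (real (run_length e u) + 1) * \<beta>"
    by (metis (mono_tags) of_int_1 of_int_add of_int_le_iff of_int_mult of_int_of_nat_eq)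
  also have "\<dots> \<le> den u * (3 * real_of_int (den u) powr e) * M"
    using run_length_bounds[OF u \<open>0 < e\<close>] den_bounds(3)[OF u] \<beta> by (intro mult_mono) auto
  also have "\<dots> = 3 * real_of_int M * real_of_int (den u) powr (1 + e)"
    using den_bounds(3)[OF u] by (simp add: powr_add)
  finally show ?thesis .
qed

lemma digits_ge2_insert_runs:
  assumes "\<And>n. 2 \<le> b n" "2 \<le> \<beta>"
  shows "digits_ge2 (insert_runs e \<beta> S b n)"
  using set_insert_runs[of e \<beta> S b n] assms by fastforce

lemma den_insert_runs_le_bound:
  assumes b: "\<And>n. 2 \<le> b n" "\<And>n. b n \<le> M" and \<beta>: "2 \<le> \<beta>" "\<beta> \<le> M" and "0 < e"
  shows "den (insert_runs e \<beta> S b n) \<le> den_bound e M n"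
proof (induction n)
  case (Suc n)
  let ?W = "insert_runs e \<beta> S b n"
  let ?u = "?W @ [b n]"
  have W: "digits_ge2 ?W" using b \<beta> by (intro digits_ge2_insert_runs)
  have u: "digits_ge2 ?u" using W b by auto
  have "den ?u \<le> den ?W * b n" using den_append_le[of ?W "[b n]"] W b by auto
  then have "real_of_int (den ?u) \<le> real_of_int (den ?W) * b n" by (metis of_int_le_iff of_int_mult)
  also have "\<dots> \<le> den_bound e M n * M"
    using Suc b[of n] den_bounds(3)[OF W] by (intro mult_mono) auto
  finally have q: "real_of_int (den ?u) \<le> den_bound e M n * M" .
  have "1 \<le> den ?u" using den_bounds(3)[OF u] by simp
  have "3 * real_of_int M * real_of_int (den ?u) powr (1 + e) \<le> 3 * real_of_int M * (den_bound e M n * M) powr (1 + e)"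
    using q \<open>1 \<le> den ?u\<close> \<open>0 < e\<close> \<beta> by (intro mult_left_mono powr_mono2) (auto simp del: continuant_snoc)
  moreover have "den (insert_runs e \<beta> S b (Suc n)) \<le> 3 * real_of_int M * real_of_int (den ?u) powr (1 + e)"
  proof (cases "Suc n \<in> S")
    case True
    then show ?thesis using den_append_run[OF u \<open>0 < e\<close> \<beta>] by simp
  next
    case False
    have "real_of_int (den ?u) \<le> real_of_int (den ?u) powr (1 + e)"
      using powr_mono[of 1 "1 + e" "real_of_int (den ?u)"] \<open>0 < e\<close> \<open>1 \<le> den ?u\<close>
      by (simp del: continuant_snoc)
    also have "\<dots> \<le> (3 * M) * real_of_int (den ?u) powr (1 + e)"
      using \<beta> by (simp add: mult_le_cancel_right1)
    finally show ?thesis using False by simp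
  qed
  ultimately show ?case by simp
qed simp

text \<open>The factor contributed by everything inserted before the last run is absorbed by sparseness.
  The three factors \<open>1 + e\<close> in the exponent come from that absorption, from the length of the
  last run, and from the loss of \<open>den\<close> against \<open>den - den'\<close> in \<open>den_append_ge\<close>.\<close>

lemma den_insert_runs_le:
  fixes c e :: real
  assumes b: "\<And>n. 2 \<le> b n" "\<And>n. b n \<le> M" and \<beta>: "2 \<le> \<beta>" "\<beta> \<le> M" and e: "0 < e"
    and sparse: "\<And>a k. a \<in> S \<Longrightarrow> k \<in> S \<Longrightarrow> a < k \<Longrightarrow> den_bound e M a \<le> real k powr e"
    and c: "0 < c" "c \<le> 1"
    and dioph: "\<And>n. c * den (prefix b n) \<le> real_of_int (den (prefix b n) - den' (prefix b n)) powr (1 + e)"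
  shows "den (insert_runs e \<beta> S b n)
    \<le> 3 * real_of_int M * (1 / c) powr ((1 + e)^2) * real_of_int (den (prefix b n)) powr ((1 + e)^3)"
proof -
  let ?W = "insert_runs e \<beta> S b" and ?D = "\<lambda>n. real_of_int (den (prefix b n))"
  have ge2: "digits_ge2 (?W n)" "digits_ge2 (map b l)" for n l
    using digits_ge2_insert_runs[of b \<beta>, OF b(1) \<beta>(1)] b(1) by simp_all
  have D1: "real n + 1 \<le> ?D n" for n
    using den_bounds(3)[OF ge2(2), of "[0..<n]"] by simp
  have D1': "1 \<le> ?D n" for n using D1[of n] by simp
  have e1: "1 \<le> (1 + e) ^ k" for k using e by simp
  \<comment> \<open>After the last insertion place \<open>k\<close> the word copies original digits;
    \<open>k = 0\<close> stands for no insertion so far.\<close>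
  obtain k where k: "k \<le> n" "k = 0 \<or> k \<in> S" and kmax: "\<And>m. k < m \<Longrightarrow> m \<le> n \<Longrightarrow> m \<notin> S"
    using last_insertion_exists[of n S] by blast
  show ?thesis
  proof (cases "k = 0")
    case True
    then have "?W n = ?W 0 @ map b [0..<n]" using kmax
      by (intro insert_runs_no_insertion) auto
    then have "real_of_int (den (?W n)) = ?D n" by simp
    also have "\<dots> \<le> ?D n powr ((1 + e)^3)"
      using powr_mono[OF e1[of 3] D1'[of n]] D1'[of n] by simp
    also have "\<dots> \<le> (3 * real_of_int M * (1 / c) powr ((1 + e)^2)) * ?D n powr ((1 + e)^3)"
    proof -
      have "1 \<le> (1 / c) powr ((1 + e)^2)" using c e1[of 2] by (intro ge_one_powr_ge_zero) auto
      then have "1 * 1 \<le> (3 * real_of_int M) * (1 / c) powr ((1 + e)^2)" using \<beta> by (intro mult_mono) auto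
      then show ?thesis by (simp add: mult_le_cancel_right1)
    qed
    finally show ?thesis .
  next
    case False
    obtain j where j: "k = Suc j" "Suc j \<in> S" using k False by (cases k) auto
    \<comment> \<open>\<open>a\<close> is the insertion place before \<open>k\<close>, or 0.
      Sparseness bounds the whole denominator accumulated up to \<open>a\<close> by
      \<open>k powr e\<close>, hence by a small power of the original denominator at
      \<open>k\<close>, which is at least \<open>k + 1\<close>.\<close>
    obtain a where a: "a \<le> j" "a = 0 \<or> a \<in> S" "\<And>m. a < m \<Longrightarrow> m \<le> j \<Longrightarrow> m \<notin> S"
      using last_insertion_exists[of j S] by blast
    let ?u = "?W j @ [b j]"
    have u2: "digits_ge2 ?u" using ge2(1)[of j] b by auto
    have "?W j = ?W a @ map b [a..<j]" using a by (intro insert_runs_no_insertion) auto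
    then have u: "?u = ?W a @ map b [a..<k]" using a j by simp
    have Pa: "real_of_int (den (?W a)) \<le> ?D k powr e"
    proof (cases "a = 0")
      case True
      then show ?thesis using D1'[of k] e by (simp add: ge_one_powr_ge_zero)
    next
      case False
      then have "den_bound e M a \<le> real k powr e" using a j k by (intro sparse) auto
      also have "\<dots> \<le> ?D k powr e" using D1[of k] e by (intro powr_mono2) auto
      finally show ?thesis using den_insert_runs_le_bound[of b, OF b \<beta> e, of S a] by linarith
    qed
    have bk: "den (map b [a..<k]) \<le> den (prefix b k)"
    proof -
      have "prefix b k = prefix b a @ map b [a..<k]"
        using upt_add_eq_append[of 0 a "k - a"] a j by (simp flip: map_append)
      then show ?thesis using den_le_den_append[OF ge2(2) ge2(2), of "[a..<k]" "[0..<a]"] by simp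
    qed
    have "den ?u \<le> den (?W a) * den (map b [a..<k])"
      unfolding u by (rule den_append_le[OF ge2(1) ge2(2)])
    then have "real_of_int (den ?u) \<le> real_of_int (den (?W a)) * den (map b [a..<k])"
      by (metis of_int_le_iff of_int_mult)
    also have "\<dots> \<le> ?D k powr e * ?D k"
      using Pa bk den_bounds(3)[OF ge2(2), of "[a..<k]"] by (intro mult_mono) auto
    also have "\<dots> = ?D k powr (1 + e)" using D1'[of k] by (simp add: powr_add)
    finally have ub: "real_of_int (den ?u) \<le> ?D k powr (1 + e)" .
    have "den (?W k) \<le> 3 * real_of_int M * real_of_int (den ?u) powr (1 + e)"
      using den_append_run[OF u2 e \<beta>] k j by simp
    also have "\<dots> \<le> 3 * real_of_int M * (?D k powr (1 + e)) powr (1 + e)"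
      using ub e \<beta> den_bounds(3)[OF u2]
      by (intro mult_left_mono powr_mono2) (auto simp del: continuant_snoc)
    also have "(?D k powr (1 + e)) powr (1 + e) = ?D k powr ((1 + e)^2)"
      by (simp add: powr_powr power2_eq_square)
    \<comment> \<open>The passage to \<open>den - den'\<close> prepares the reattachment of the
      remaining digits \<open>v\<close>: only \<open>(den - den') * den v\<close> is known to be
      below the denominator of the whole original prefix.\<close>
    also have "\<dots> \<le> ((1 / c) * real_of_int (den (prefix b k) - den' (prefix b k)) powr (1 + e)) powr ((1 + e)^2)"
      using dioph[of k] c D1'[of k] by (intro powr_mono2) (auto simp: field_simps)
    also have "\<dots> = (1 / c) powr ((1 + e)^2) * real_of_int (den (prefix b k) - den' (prefix b k)) powr ((1 + e)^3)"
      using c by (subst powr_mult) (auto simp: powr_powr power2_eq_square power3_eq_cube mult.assoc)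
    finally have Wk: "den (?W k) \<le> 3 * real_of_int M * ((1 / c) powr ((1 + e)^2) *
        real_of_int (den (prefix b k) - den' (prefix b k)) powr ((1 + e)^3))"
      using \<beta> by (auto simp: mult_left_mono)
    define v where "v = map b [k..<n]"
    have v: "digits_ge2 v" "1 \<le> den v" using ge2(2)[of "[k..<n]"] den_bounds(3)[OF ge2(2)[of "[k..<n]"]]
      by (simp_all add: v_def)
    have "?W n = ?W k @ v" unfolding v_def using k kmax by (intro insert_runs_no_insertion) auto
    then have "den (?W n) \<le> den (?W k) * den v" using den_append_le[OF ge2(1) v(1), of k] by simp
    then have "real_of_int (den (?W n)) \<le> real_of_int (den (?W k)) * den v"
      by (metis of_int_le_iff of_int_mult)
    also have "\<dots> \<le> 3 * real_of_int M * ((1 / c) powr ((1 + e)^2) *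
        real_of_int (den (prefix b k) - den' (prefix b k)) powr ((1 + e)^3)) * real_of_int (den v) powr ((1 + e)^3)"
      using Wk powr_mono[OF e1[of 3], of "real_of_int (den v)"] v \<beta> by (intro mult_mono) auto
    also have "\<dots> = 3 * real_of_int M * (1 / c) powr ((1 + e)^2) *
        real_of_int ((den (prefix b k) - den' (prefix b k)) * den v) powr ((1 + e)^3)"
      using v den_bounds(2)[OF ge2(2), of "[0..<k]"] by (simp add: powr_mult)
    also have "\<dots> \<le> 3 * real_of_int M * (1 / c) powr ((1 + e)^2) * ?D n powr ((1 + e)^3)"
    proof -
      have "prefix b n = prefix b k @ v"
        using upt_add_eq_append[of 0 k "n - k"] k by (simp add: v_def flip: map_append)
      then have "(den (prefix b k) - den' (prefix b k)) * den v \<le> den (prefix b n)"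
        using den_append_ge[OF ge2(2)[of "[0..<k]"] v(1)] by simp
      moreover have "0 \<le> (den (prefix b k) - den' (prefix b k)) * den v"
        using den_bounds(2)[OF ge2(2)[of "[0..<k]"]] v by simp
      ultimately show ?thesis
        using \<beta> e by (intro mult_left_mono powr_mono2) (auto simp del: of_int_mult of_int_diff)
    qed
    finally show ?thesis .
  qed
qed

text \<open>Recursive choice: the next element exceeds \<open>\<bar>f n\<bar> powr (1 / e)\<close>
  at the present element \<open>n\<close>, and every later element is at least as large as the next
  one.\<close>

lemma sparse_set_exists:
  fixes f :: "nat \<Rightarrow> real"
  assumes "0 < e"
  shows "\<exists>S. infinite S \<and> (\<forall>a\<in>S. \<forall>k\<in>S. a < k \<longrightarrow> f a \<le> real k powr e)"
proof -
  define h where "h n = nat \<lceil>\<bar>f n\<bar> powr (1 / e)\<rceil>" for n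
  define s where "s = rec_nat (1 :: nat) (\<lambda>_ n. Suc (n + h n))"
  have s: "s 0 = 1" "s (Suc i) = Suc (s i + h (s i))" for i by (simp_all add: s_def)
  have mono: "strict_mono s" by (rule strict_mono_Suc_iff[THEN iffD2]) (simp add: s)
  have "f (s i) \<le> real (s j) powr e" if "s i < s j" for i j
  proof -
    have "Suc i \<le> j" using that strict_mono_less[OF mono] by simp
    then have "h (s i) \<le> s j" using strict_mono_leD[OF mono, of "Suc i" j] s(2)[of i] by linarith
    then have "\<bar>f (s i)\<bar> powr (1 / e) \<le> real (s j)" unfolding h_def by linarith
    then have "(\<bar>f (s i)\<bar> powr (1 / e)) powr e \<le> real (s j) powr e" using assms by (intro powr_mono2) auto
    then show ?thesis using assms by (simp add: powr_powr)
  qed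
  moreover have "infinite (range s)"
    using mono by (simp add: strict_mono_imp_inj_on range_inj_infinite)
  ultimately show ?thesis by (intro exI[of _ "range s"]) blast
qed

section \<open>Good and bad rational approximation\<close>

definition badly_approx :: "real \<Rightarrow> real \<Rightarrow> real set" where
  "badly_approx \<tau> c = {x. \<forall>p q. 0 < q \<longrightarrow> coprime p q \<longrightarrow> c * real_of_int q powr - \<tau> \<le> \<bar>x - real_of_int p / real_of_int q\<bar>}"

lemma badly_approxD:
  "x \<in> badly_approx \<tau> c \<Longrightarrow> 0 < q \<Longrightarrow> coprime p q \<Longrightarrow>
    c * real_of_int q powr - \<tau> \<le> \<bar>x - real_of_int p / real_of_int q\<bar>"
  unfolding badly_approx_def by blast

text \<open>Only finitely many reduced fractions violate the bound with constant 1, and each has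
  positive distance from the irrational \<open>x\<close>, so one constant accommodates them all.
  Constants of the form \<open>1 / (N + 1)\<close> make the decomposition countable.\<close>

lemma not_jarnik_badly_approx:
  assumes x: "x \<notin> \<rat>" "x \<notin> jarnik_set \<tau>"
  shows "\<exists>N :: nat. x \<in> badly_approx \<tau> (1 / (real N + 1))"
proof -
  define A where "A = {(p :: int, q :: nat). 0 < q \<and> coprime \<bar>p\<bar> (int q) \<and>
                          \<bar>x - real_of_int p / real q\<bar> < real q powr (- \<tau>)}"
  have "finite A"
  proof (rule ccontr)
    assume "infinite A"
    then have "ereal \<tau> \<le> irrationality_exponent x"
      unfolding irrationality_exponent_def A_def by (intro Sup_upper) blast
    then show False using x by (simp add: jarnik_set_def)
  qed
  define g where "g = (\<lambda>(p :: int, q :: nat). real q powr (- \<tau>) / \<bar>x - real_of_int p / real q\<bar>)"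
  obtain N :: nat where N: "\<And>a. a \<in> A \<Longrightarrow> g a \<le> real N"
  proof -
    obtain m where m: "\<And>a. a \<in> A \<Longrightarrow> g a \<le> m"
      using finite_imageI[OF \<open>finite A\<close>, of g] by (metis bdd_above_finite bdd_above.unfold imageI)
    moreover obtain N :: nat where "m \<le> real N" using real_arch_simple by blast
    ultimately show ?thesis using that by (meson order_trans)
  qed
  have "1 / (real N + 1) * real_of_int q powr - \<tau> \<le> \<bar>x - real_of_int p / real_of_int q\<bar>"
    if "0 < q" "coprime p q" for p q
  proof (cases "(p, nat q) \<in> A")
    case True
    have "real_of_int p / real_of_int q \<in> \<rat>" by simp
    then have pos: "0 < \<bar>x - real_of_int p / real_of_int q\<bar>" using x by auto
    have "real_of_int q powr - \<tau> / \<bar>x - real_of_int p / real_of_int q\<bar> \<le> real N + 1"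
      using N[OF True] that by (simp add: g_def)
    then show ?thesis using pos by (simp add: field_simps)
  next
    case False
    then have "real_of_int q powr - \<tau> \<le> \<bar>x - real_of_int p / real_of_int q\<bar>"
      using that by (simp add: A_def)
    moreover have "1 / (real N + 1) * real_of_int q powr - \<tau> \<le> 1 * real_of_int q powr - \<tau>"
      by (intro mult_right_mono) auto
    ultimately show ?thesis by linarith
  qed
  then show ?thesis unfolding badly_approx_def by blast
qed

text \<open>One distance is bounded in two ways: with \<open>t - 1\<close>, which is small before a
  long run of 2s, to show that a point is well approximable; and without \<open>t\<close>, to draw a
  lower bound on \<open>d\<close> from bad approximability.\<close>

lemma mobius_diff_1_pos:
  fixes t d :: real
  assumes "digits_ge2 w" "1 < t"
  defines "d \<equiv> real_of_int (den w - den' w)"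
  shows "1 \<le> d" "0 < (t - 1) / ((den w * t - den' w) * d)"
    "(t - 1) / ((den w * t - den' w) * d) \<le> (t - 1) / d\<^sup>2"
    "(t - 1) / ((den w * t - den' w) * d) \<le> 1 / (den w * d)"
proof -
  have D: "1 \<le> real_of_int (den w)" using den_bounds(3)[OF assms(1)] by simp
  show d: "1 \<le> d" using den_bounds(2)[OF assms(1)] unfolding d_def by linarith
  have m: "d \<le> den w * t - den' w" "0 < den w * t - den' w"
    using mobius_den_pos[OF assms(1,2)] by (simp_all add: d_def)
  then show "0 < (t - 1) / ((den w * t - den' w) * d)" using d assms(2) by simp
  show "(t - 1) / ((den w * t - den' w) * d) \<le> (t - 1) / d\<^sup>2"
    using m d assms(2) unfolding power2_eq_square
    by (intro divide_left_mono mult_right_mono mult_pos_pos) auto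
  have "(t - 1) * den w \<le> den w * t - den' w"
    using d by (simp add: d_def algebra_simps)
  then have "(t - 1) / (den w * t - den' w) \<le> 1 / den w"
    using m D by (simp add: field_simps)
  then have "(t - 1) / (den w * t - den' w) / d \<le> 1 / den w / d"
    using d by (intro divide_right_mono) auto
  then show "(t - 1) / ((den w * t - den' w) * d) \<le> 1 / (den w * d)" by simp
qed

lemma bcf_expansion_near_convergent:
  fixes t :: "nat \<Rightarrow> real"
  assumes "bcf_expansion x b t"
  defines "w \<equiv> \<lambda>n. prefix b n"
  shows "\<bar>x - real_of_int (num (w n) - num' (w n)) / real_of_int (den (w n) - den' (w n))\<bar>
    = (t n - 1) / ((den (w n) * t n - den' (w n)) * real_of_int (den (w n) - den' (w n)))"
proof -
  have "x - real_of_int (num (w n) - num' (w n)) / real_of_int (den (w n) - den' (w n))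
    = (t n - 1) / ((den (w n) * t n - den' (w n)) * real_of_int (den (w n) - den' (w n)))"
    using mobius_diff_1[OF digits_ge2_prefix[OF assms(1)] bcf_expansionD(2)[OF assms(1)], of n n]
      bcf_expansion_mobius[OF assms(1), of n] by (simp add: w_def)
  then show ?thesis
    using mobius_diff_1_pos(2)[OF digits_ge2_prefix[OF assms(1)] bcf_expansionD(2)[OF assms(1)], of n n]
    unfolding w_def by (simp only: abs_of_pos)
qed

text \<open>Bad approximability is tested on the reduced fraction with denominator
  \<open>d = den - den'\<close>, whose error is at most \<open>1 / (den * d)\<close>.\<close>

lemma badly_approx_den_le:
  fixes t :: "nat \<Rightarrow> real"
  assumes x: "bcf_expansion x b t" and bad: "x \<in> badly_approx (2 + e) c"
  shows "c * den (prefix b n) \<le> real_of_int (den (prefix b n) - den' (prefix b n)) powr (1 + e)"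
proof -
  define w where "w = prefix b n"
  have w: "digits_ge2 w" unfolding w_def by (rule digits_ge2_prefix[OF x])
  have t: "1 < t n" by (rule bcf_expansionD(2)[OF x])
  define d where "d = real_of_int (den w - den' w)"
  have d: "1 \<le> d" unfolding d_def by (rule mobius_diff_1_pos(1)[OF w t])
  have D: "1 \<le> real_of_int (den w)" using den_bounds(3)[OF w] by simp
  have "c * d powr - (2 + e) \<le> \<bar>x - real_of_int (num w - num' w) / real_of_int (den w - den' w)\<bar>"
    unfolding d_def using den_bounds(2)[OF w]
    by (intro badly_approxD[OF bad _ coprime_continuant_diff]) linarith
  also have "\<dots> \<le> 1 / (den w * d)"
    using mobius_diff_1_pos(4)[OF w t] bcf_expansion_near_convergent[OF x, of n] by (simp add: w_def d_def)
  finally have le: "c * d powr - (2 + e) \<le> 1 / (den w * d)" .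
  define P where "P = d powr (1 + e)"
  have "0 < P" using d by (simp add: P_def)
  have "d powr (2 + e) = P * d" using powr_add[of d "1 + e" 1] d by (simp add: P_def algebra_simps)
  then have "d powr - (2 + e) = 1 / (P * d)" by (simp only: powr_minus_divide)
  then have "c / (P * d) \<le> 1 / (den w * d)" using le by simp
  then have "c * den w \<le> P" using D d \<open>0 < P\<close> by (simp add: field_simps)
  then show ?thesis by (simp add: P_def d_def w_def)
qed

text \<open>In the coordinate \<open>1 / (t - 1)\<close> reading a digit 2 subtracts 1. The
  coordinate stays positive, so before \<open>r\<close> such digits it exceeds
  \<open>r\<close>.\<close>

lemma tail_run_of_2:
  fixes t :: "nat \<Rightarrow> real"
  assumes x: "bcf_expansion x b t" and run: "\<And>i. i < r \<Longrightarrow> b (n + i) = 2"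
  shows "real r * (t n - 1) < 1"
proof -
  have "1 / (t n - 1) = real r + 1 / (t (n + r) - 1)"
    using run
  proof (induction r)
    case (Suc r)
    have t: "t (n + r) = 2 - 1 / t (Suc (n + r))" "1 < t (Suc (n + r))"
      using bcf_expansionD(2)[OF x, of "Suc (n + r)"] bcf_expansionD(3)[OF x, of "n + r"] Suc.prems[of r] by auto
    have "1 / (t (n + r) - 1) = 1 + 1 / (t (Suc (n + r)) - 1)"
      unfolding t(1) using t(2) by (simp add: field_simps)
    then show ?case using Suc by simp
  qed simp
  moreover have "0 < 1 / (t (n + r) - 1)" using bcf_expansionD(2)[OF x] by simp
  ultimately have "real r < 1 / (t n - 1)" by linarith
  then show ?thesis using bcf_expansionD(2)[OF x, of n] by (simp add: field_simps)
qed

text \<open>At the start of a run of length \<open>r\<close> the tail \<open>s\<close> satisfies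
  \<open>s - 1 < 1 / r\<close>, which is at most \<open>d powr - e\<close>; the error of the
  fraction with denominator \<open>d\<close> is at most \<open>(s - 1) / d^2\<close>.\<close>

lemma jarnik_set_if_inserted_runs:
  fixes t :: "nat \<Rightarrow> real"
  assumes x: "bcf_expansion x (inserted_seq e \<beta> S b) t" and S: "infinite S" and e: "0 < e"
    and b: "\<And>n. 2 \<le> b n" and \<beta>: "2 \<le> \<beta>"
  shows "x \<in> jarnik_set (2 + e)"
proof -
  define A where "A = {(p :: int, q :: nat). 0 < q \<and> coprime \<bar>p\<bar> (int q) \<and>
                          \<bar>x - real_of_int p / real q\<bar> < real q powr (- (2 + e))}"
  \<comment> \<open>The second conjunct yields infinitely many different fractions: it makes the
    errors tend to 0, which finitely many fractions cannot do for an irrational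
    \<open>x\<close>.\<close>
  have ex: "\<exists>p q. (p, q) \<in> A \<and> \<bar>x - real_of_int p / real q\<bar> * real k powr e < 1" if k: "k \<in> S" "0 < k" for k
  proof -
    obtain j where j: "k = Suc j" using k by (cases k) auto
    define u where "u = insert_runs e \<beta> S b j @ [b j]"
    let ?r = "run_length e u"
    have split: "insert_runs e \<beta> S b k = u @ (replicate ?r 2 @ [\<beta>])"
      using k j by (simp add: u_def)
    have pre: "prefix (inserted_seq e \<beta> S b) (length u) = u"
      by (rule prefix_inserted_seq[OF split])
    have u: "digits_ge2 u"
      using digits_ge2_insert_runs[of b \<beta>, OF b \<beta>] b by (simp add: u_def)
    define s where "s = t (length u)"
    have s: "1 < s" unfolding s_def by (rule bcf_expansionD(2)[OF x])
    define d where "d = real_of_int (den u - den' u)"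
    note bounds = mobius_diff_1_pos[OF u s, folded d_def]
    have run: "real ?r * (s - 1) < 1"
      unfolding s_def
      by (rule tail_run_of_2[OF x]) (simp add: inserted_seq_append_nth[OF split] nth_append)
    have "j + 1 \<le> length u" using length_insert_runs[of j e \<beta> S b] by (simp add: u_def)
    then have k': "real k \<le> den u" using den_bounds(3)[OF u] j by linarith
    have d': "d \<le> den u" using den_bounds(1)[OF u] by (simp add: d_def)
    have lt: "(s - 1) * real_of_int (den u) powr e < 1"
    proof -
      have "(s - 1) * real_of_int (den u) powr e \<le> (s - 1) * ?r"
        using run_length_bounds(1)[OF u e] s by (intro mult_left_mono) auto
      then show ?thesis using run by (simp add: mult.commute)
    qed
    have dist: "\<bar>x - real_of_int (num u - num' u) / d\<bar> \<le> (s - 1) / d\<^sup>2"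
      using bcf_expansion_near_convergent[OF x, of "length u"] bounds(3) unfolding pre d_def s_def by simp
    also have "\<dots> < d powr - (2 + e)"
    proof -
      have "(s - 1) * d powr e \<le> (s - 1) * real_of_int (den u) powr e"
        using d' bounds(1) e s by (intro mult_left_mono powr_mono2) auto
      then have "(s - 1) * d powr e < 1" using lt by linarith
      then have "s - 1 < 1 / d powr e" using bounds(1) by (simp add: field_simps)
      then have "(s - 1) / d\<^sup>2 < 1 / d powr e / d\<^sup>2"
        using bounds(1) by (intro divide_strict_right_mono) auto
      also have "\<dots> = 1 / d powr (2 + e)" using bounds(1) by (simp add: powr_add mult.commute)
      also have "\<dots> = d powr - (2 + e)" by (simp only: powr_minus_divide)
      finally show ?thesis .
    qed
    finally have in_A: "(num u - num' u, nat (den u - den' u)) \<in> A"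
      using den_bounds(2)[OF u] coprime_continuant_diff[of u] by (simp add: A_def d_def)
    have "\<bar>x - real_of_int (num u - num' u) / d\<bar> \<le> s - 1"
    proof -
      have "(s - 1) / d\<^sup>2 \<le> (s - 1) / 1" using s bounds(1) by (intro divide_left_mono) auto
      then show ?thesis using dist by simp
    qed
    then have "\<bar>x - real_of_int (num u - num' u) / d\<bar> * real k powr e \<le> (s - 1) * real_of_int (den u) powr e"
      using k' e s by (intro mult_mono powr_mono2) auto
    then have "\<bar>x - real_of_int (num u - num' u) / d\<bar> * real k powr e < 1" using lt by linarith
    moreover have "d = real (nat (den u - den' u))" using den_bounds(2)[OF u] by (simp add: d_def)
    ultimately show ?thesis using in_A by metis
  qed
  have irr: "x \<notin> \<rat>" using x by (rule bcf_expansion_irrational)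
  have "infinite A"
  proof
    assume "finite A"
    define g where "g = (\<lambda>(p :: int, q :: nat). 1 / \<bar>x - real_of_int p / real q\<bar>)"
    obtain m where m: "\<And>a. a \<in> A \<Longrightarrow> g a \<le> m"
      using finite_imageI[OF \<open>finite A\<close>, of g] by (metis bdd_above_finite bdd_above.unfold imageI)
    obtain N :: nat where N: "\<bar>m\<bar> powr (1 / e) \<le> real N" using real_arch_simple by blast
    obtain k where k: "k \<in> S" "N < k" using S by (meson infinite_nat_iff_unbounded)
    then obtain p q where pq: "(p, q) \<in> A" "\<bar>x - real_of_int p / real q\<bar> * real k powr e < 1"
      using ex[of k] by auto
    have "real_of_int p / real q \<in> \<rat>" by simp
    then have pos: "0 < \<bar>x - real_of_int p / real q\<bar>" using irr by auto
    have "real k powr e < g (p, q)" using pq(2) pos by (simp add: g_def field_simps)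
    also have "\<dots> \<le> \<bar>m\<bar>" using m[OF pq(1)] by simp
    also have "\<dots> = (\<bar>m\<bar> powr (1 / e)) powr e" using e by (simp add: powr_powr)
    also have "\<dots> \<le> real k powr e" using N k e by (intro powr_mono2) auto
    finally show False by simp
  qed
  then have "ereal (2 + e) \<le> irrationality_exponent x"
    unfolding irrationality_exponent_def A_def by (intro Sup_upper) blast
  then show ?thesis using irr by (simp add: jarnik_set_def)
qed

section \<open>Distances before and after the insertion\<close>

lemma bcf_expansion_dist_le:
  fixes t s :: "nat \<Rightarrow> real" and M :: int
  assumes x: "bcf_expansion x b t" and y: "bcf_expansion y d s"
    and same: "prefix b n = prefix d n" and M: "b n \<le> M" "d n \<le> M"
  shows "\<bar>x - y\<bar> \<le> M / (real_of_int (den (prefix b n) - den' (prefix b n)))\<^sup>2"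
proof -
  define w where "w = prefix b n"
  have w: "digits_ge2 w" unfolding w_def by (rule digits_ge2_prefix[OF x])
  have t: "1 < t n" "t n < M" and s: "1 < s n" "s n < M"
    using bcf_expansionD(2,5)[OF x, of n] bcf_expansionD(2,5)[OF y, of n] M by (auto intro: less_le_trans)
  have d: "1 \<le> real_of_int (den w - den' w)" using den_bounds(2)[OF w] by linarith
  note mt = mobius_den_pos[OF w t(1)] and ms = mobius_den_pos[OF w s(1)]
  have "x - y = (t n - s n) / ((den w * t n - den' w) * (den w * s n - den' w))"
    using mobius_diff[OF w t(1) s(1)] bcf_expansion_mobius[OF x, of n, folded w_def]
      bcf_expansion_mobius[OF y, of n, folded same, folded w_def] by simp
  then have "\<bar>x - y\<bar> = \<bar>t n - s n\<bar> / ((den w * t n - den' w) * (den w * s n - den' w))"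
    using mt ms by (simp add: abs_mult)
  also have "\<dots> \<le> M / (real_of_int (den w - den' w))\<^sup>2"
    unfolding power2_eq_square using mt ms d t s by (intro frac_le mult_mono mult_pos_pos) auto
  finally show ?thesis by (simp add: w_def)
qed

text \<open>The tails lie in different intervals \<open>(b n - 1, b n)\<close> and
  \<open>(d n - 1, d n)\<close>, and each stays \<open>1 / M\<close> below the upper end because its
  successor is below \<open>M\<close>. This gap gives one factor \<open>M\<close>; the other two
  come from bounding the two Moebius denominators by \<open>den w * M\<close>.\<close>

lemma bcf_expansion_dist_ge:
  fixes t s :: "nat \<Rightarrow> real" and M :: int
  assumes x: "bcf_expansion x b t" and y: "bcf_expansion y d s"
    and same: "prefix b n = prefix d n" and diff: "b n \<noteq> d n"
    and M: "\<And>n. b n \<le> M" "\<And>n. d n \<le> M"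
  shows "1 / (real_of_int M ^ 3 * (real_of_int (den (prefix b n)))\<^sup>2) \<le> \<bar>x - y\<bar>"
proof -
  define w where "w = prefix b n"
  have w: "digits_ge2 w" unfolding w_def by (rule digits_ge2_prefix[OF x])
  have t: "1 < t n" "t n < M" for n using bcf_expansionD(2,5)[OF x, of n] M(1)[of n] by (auto intro: less_le_trans)
  have s: "1 < s n" "s n < M" for n using bcf_expansionD(2,5)[OF y, of n] M(2)[of n] by (auto intro: less_le_trans)
  have M1: "1 < real_of_int M" using t[of 0] by linarith
  have D: "1 \<le> real_of_int (den w)" using den_bounds(3)[OF w] by simp
  have gap: "1 / M < b n - t n" "1 / M < d n - s n"
    using bcf_expansionD(3)[OF x, of n] bcf_expansionD(3)[OF y, of n] t[of "Suc n"] s[of "Suc n"]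
    by (auto intro!: divide_strict_left_mono mult_pos_pos simp: M1)
  have ts: "1 / M \<le> \<bar>t n - s n\<bar>"
  proof (cases "b n < d n")
    case True
    then have "real_of_int (b n) + 1 \<le> d n" by linarith
    then show ?thesis using gap bcf_expansionD(4)[OF y, of n] by linarith
  next
    case False
    then have "real_of_int (d n) + 1 \<le> b n" using diff by linarith
    then show ?thesis using gap bcf_expansionD(4)[OF x, of n] by linarith
  qed
  note mt = mobius_den_pos[OF w t(1)[of n]] and ms = mobius_den_pos[OF w s(1)[of n]]
  have ub: "den w * t n - den' w \<le> real_of_int (den w) * real_of_int M" "den w * s n - den' w \<le> real_of_int (den w) * real_of_int M"
  proof -
    have "den w * t n \<le> real_of_int (den w) * real_of_int M" "den w * s n \<le> real_of_int (den w) * real_of_int M"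
      using t(2)[of n] s(2)[of n] D by (auto intro!: mult_left_mono)
    then show "den w * t n - den' w \<le> real_of_int (den w) * real_of_int M" "den w * s n - den' w \<le> real_of_int (den w) * real_of_int M"
      using den_bounds(1)[OF w] by auto
  qed
  have "1 / (real_of_int M ^ 3 * (real_of_int (den w))\<^sup>2) = (1 / M) / ((real_of_int (den w) * real_of_int M) * (real_of_int (den w) * real_of_int M))"
    by (simp add: power2_eq_square power3_eq_cube)
  also have "\<dots> \<le> \<bar>t n - s n\<bar> / ((den w * t n - den' w) * (den w * s n - den' w))"
    using mt ms ub ts M1 D by (intro frac_le mult_mono mult_pos_pos) auto
  also have "\<dots> = \<bar>x - y\<bar>"
  proof -
    have "x - y = (t n - s n) / ((den w * t n - den' w) * (den w * s n - den' w))"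
      using mobius_diff[OF w t(1)[of n] s(1)[of n]] bcf_expansion_mobius[OF x, of n, folded w_def]
        bcf_expansion_mobius[OF y, of n, folded same, folded w_def] by simp
    then show ?thesis using mt ms by (simp add: abs_mult)
  qed
  finally show ?thesis by (simp add: w_def)
qed

text \<open>Let \<open>D\<close> be the original denominator of the common prefix. Up to constants,
  the old distance is at most \<open>D powr - (2 / (1 + e))\<close> and the new one at least
  \<open>D powr - (2 * (1 + e)^3)\<close>; the quotient of the exponents is
  \<open>\<gamma>\<close>.\<close>

lemma insertion_inverse_Holder:
  fixes t s t' s' :: "nat \<Rightarrow> real" and e c \<gamma> C :: real and M :: int
  assumes x: "bcf_expansion x b t" and y: "bcf_expansion y d s"
    and x': "bcf_expansion x' (inserted_seq e \<beta> S b) t'" and y': "bcf_expansion y' (inserted_seq e \<beta> S d) s'"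
    and M: "\<And>n. b n \<le> M" "\<And>n. d n \<le> M" and \<beta>: "2 \<le> \<beta>" "\<beta> \<le> M" and e: "0 < e"
    and sparse: "\<And>a k. a \<in> S \<Longrightarrow> k \<in> S \<Longrightarrow> a < k \<Longrightarrow> den_bound e M a \<le> real k powr e"
    and c: "0 < c" "c \<le> 1" and bad: "x \<in> badly_approx (2 + e) c"
  defines "\<gamma> \<equiv> 1 / (1 + e) ^ 4" and "C \<equiv> 3 * real_of_int M * (1 / c) powr ((1 + e)^2)"
  shows "\<bar>x - y\<bar> \<le> M * (1 / c) powr (2 / (1 + e)) * (real_of_int M ^ 3 * C\<^sup>2) powr \<gamma> * \<bar>x' - y'\<bar> powr \<gamma>"
proof -
  have b: "2 \<le> b n" for n by (rule bcf_expansionD(6)[OF x])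
  have d2: "2 \<le> d n" for n by (rule bcf_expansionD(6)[OF y])
  have M2: "2 \<le> M" using \<beta> by simp
  let ?D = "\<lambda>n. real_of_int (den (prefix b n))"
  have D1: "real n + 1 \<le> ?D n" for n
    using den_bounds(3)[OF digits_ge2_prefix[OF x, of n]] by simp
  have dioph: "c * ?D n \<le> real_of_int (den (prefix b n) - den' (prefix b n)) powr (1 + e)" for n
    by (rule badly_approx_den_le[OF x bad])
  have upper: "\<bar>x - y\<bar> \<le> M * (1 / (c * ?D n)) powr (2 / (1 + e))" if "prefix b n = prefix d n" for n
  proof -
    define q where "q = real_of_int (den (prefix b n) - den' (prefix b n))"
    have q: "1 \<le> q" using den_bounds(2)[OF digits_ge2_prefix[OF x, of n]] unfolding q_def by linarith
    have "(c * ?D n) powr (2 / (1 + e)) \<le> (q powr (1 + e)) powr (2 / (1 + e))"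
      using dioph[of n] c D1[of n] e unfolding q_def by (intro powr_mono2) auto
    also have "\<dots> = q powr ((1 + e) * (2 / (1 + e)))" by (simp only: powr_powr)
    also have "(1 + e) * (2 / (1 + e)) = 2" using e by (simp add: divide_eq_eq algebra_simps)
    also have "q powr 2 = q\<^sup>2" using q by simp
    finally have "(c * ?D n) powr (2 / (1 + e)) \<le> q\<^sup>2" .
    moreover have "0 < (c * ?D n) powr (2 / (1 + e))" using c D1[of n] by simp
    ultimately have "M / q\<^sup>2 \<le> M / (c * ?D n) powr (2 / (1 + e))"
      using M2 by (intro divide_left_mono mult_pos_pos) auto
    also have "\<dots> = M * (1 / (c * ?D n)) powr (2 / (1 + e))"
      using c D1[of n] by (simp add: powr_divide)
    finally show ?thesis using bcf_expansion_dist_le[OF x y that M] unfolding q_def by linarith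
  qed
  show ?thesis
  proof (cases "\<exists>n. b n \<noteq> d n")
    case False
    \<comment> \<open>The upper bound holds for every common prefix and tends to 0, since
      \<open>?D n \<ge> n + 1\<close>.\<close>
    have "x = y"
    proof (rule ccontr)
      assume "x \<noteq> y"
      have "(\<lambda>n. M * (1 / (c * (real n + 1))) powr (2 / (1 + e))) \<longlonglongrightarrow> real_of_int M * 0"
      proof (intro tendsto_mult tendsto_const)
        have "(\<lambda>n. 1 / c * inverse (real (Suc n))) \<longlonglongrightarrow> 1 / c * 0"
          by (intro tendsto_intros LIMSEQ_inverse_real_of_nat)
        then have "(\<lambda>n. 1 / (c * (real n + 1))) \<longlonglongrightarrow> 0"
          using c by (simp add: field_simps)
        then show "(\<lambda>n. (1 / (c * (real n + 1))) powr (2 / (1 + e))) \<longlonglongrightarrow> 0"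
          using e c by (intro tendsto_zero_powrI[where b = "2 / (1 + e)"]) (auto simp: add_nonneg_nonneg)
      qed
      moreover have "\<bar>x - y\<bar> \<le> M * (1 / (c * (real n + 1))) powr (2 / (1 + e))" for n
      proof -
        have "(1 / (c * ?D n)) powr (2 / (1 + e)) \<le> (1 / (c * (real n + 1))) powr (2 / (1 + e))"
          using c e D1[of n] by (intro powr_mono2 divide_left_mono mult_left_mono mult_pos_pos) auto
        then have "M * (1 / (c * ?D n)) powr (2 / (1 + e)) \<le> M * (1 / (c * (real n + 1))) powr (2 / (1 + e))"
          using M2 by (intro mult_left_mono) auto
        then show ?thesis using upper[of n] False by simp
      qed
      ultimately have "\<bar>x - y\<bar> \<le> real_of_int M * 0" by (intro LIMSEQ_le_const) auto
      then show False using \<open>x \<noteq> y\<close> by simp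
    qed
    then show ?thesis using M2 by simp
  next
    case True
    define n where "n = (LEAST n. b n \<noteq> d n)"
    have n: "b n \<noteq> d n" using True unfolding n_def by (rule LeastI_ex)
    have lt: "b i = d i" if "i < n" for i using not_less_Least[of i "\<lambda>n. b n \<noteq> d n"] that unfolding n_def by blast
    \<comment> \<open>Insertions up to stage \<open>n\<close> depend only on the common digits, so
      the first difference moves to index \<open>length ?W\<close> in both new sequences.\<close>
    let ?W = "insert_runs e \<beta> S b n" and ?B = "inserted_seq e \<beta> S b" and ?E = "inserted_seq e \<beta> S d"
    have W: "insert_runs e \<beta> S d n = ?W" using lt by (intro insert_runs_cong) auto
    have pre: "prefix ?B (length ?W) = ?W" "prefix ?E (length ?W) = ?W"
      using prefix_inserted_seq[of e \<beta> S b n ?W "[]"] prefix_inserted_seq[of e \<beta> S d n ?W "[]"] W by simp_all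
    have nth: "?B (length ?W) = b n" "?E (length ?W) = d n"
      using inserted_seq_append_nth[of e \<beta> S b "Suc n" ?W _ 0] inserted_seq_append_nth[of e \<beta> S d "Suc n" ?W _ 0] W
      by simp_all
    have le: "?B i \<le> M" "?E i \<le> M" for i
      using inserted_seq_in[of e \<beta> S b i] inserted_seq_in[of e \<beta> S d i] M \<beta> by auto
    have Wd: "1 \<le> real_of_int (den ?W)"
      using den_bounds(3)[OF digits_ge2_insert_runs[of b \<beta> e S n, OF b \<beta>(1)]] by simp
    have C: "0 < C" using M2 c by (simp add: C_def)
    have "real_of_int (den ?W) \<le> C * ?D n powr ((1 + e)^3)"
      unfolding C_def using b M(1) \<beta> e sparse c dioph by (rule den_insert_runs_le)
    then have "(real_of_int (den ?W))\<^sup>2 \<le> (C * ?D n powr ((1 + e)^3))\<^sup>2"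
      using Wd by (intro power_mono) auto
    also have "\<dots> = C\<^sup>2 * ?D n powr (2 * (1 + e)^3)"
      using D1[of n] by (simp add: power_mult_distrib powr_power mult.commute)
    finally have "real_of_int M ^ 3 * (real_of_int (den ?W))\<^sup>2 \<le> real_of_int M ^ 3 * (C\<^sup>2 * ?D n powr (2 * (1 + e)^3))"
      using M2 by (intro mult_left_mono) auto
    then have "1 / (real_of_int M ^ 3 * (C\<^sup>2 * ?D n powr (2 * (1 + e)^3))) \<le> 1 / (real_of_int M ^ 3 * (real_of_int (den ?W))\<^sup>2)"
      using M2 C Wd D1[of n] by (intro divide_left_mono mult_pos_pos) auto
    also have "\<dots> \<le> \<bar>x' - y'\<bar>"
      using bcf_expansion_dist_ge[OF x' y' _ _ le, of "length ?W"] n by (simp add: pre nth)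
    finally have lower: "1 \<le> (real_of_int M ^ 3 * C\<^sup>2) * \<bar>x' - y'\<bar> * ?D n powr (2 * (1 + e)^3)"
      using M2 C D1[of n] by (simp add: field_simps)
    have "1 \<le> ((real_of_int M ^ 3 * C\<^sup>2) * \<bar>x' - y'\<bar> * ?D n powr (2 * (1 + e)^3)) powr \<gamma>"
      using lower e by (intro ge_one_powr_ge_zero) (auto simp: \<gamma>_def)
    also have "\<dots> = (real_of_int M ^ 3 * C\<^sup>2) powr \<gamma> * \<bar>x' - y'\<bar> powr \<gamma> * ?D n powr (2 * (1 + e)^3 * \<gamma>)"
      using M2 C by (simp add: powr_mult powr_powr)
    also have "2 * (1 + e)^3 * \<gamma> = 2 / (1 + e)"
      using e power_add[of "1 + e" 3 1] by (simp add: \<gamma>_def)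
    finally have "(1 / ?D n) powr (2 / (1 + e)) * 1 \<le>
        (1 / ?D n) powr (2 / (1 + e)) * ((real_of_int M ^ 3 * C\<^sup>2) powr \<gamma> * \<bar>x' - y'\<bar> powr \<gamma> * ?D n powr (2 / (1 + e)))"
      by (intro mult_left_mono) auto
    also have "\<dots> = (real_of_int M ^ 3 * C\<^sup>2) powr \<gamma> * \<bar>x' - y'\<bar> powr \<gamma>"
      using D1[of n] by (simp add: powr_divide)
    finally have fin: "(1 / ?D n) powr (2 / (1 + e)) \<le> (real_of_int M ^ 3 * C\<^sup>2) powr \<gamma> * \<bar>x' - y'\<bar> powr \<gamma>" by simp
    have "prefix b n = prefix d n" using lt by simp
    then have "\<bar>x - y\<bar> \<le> M * (1 / (c * ?D n)) powr (2 / (1 + e))" by (rule upper)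
    also have "\<dots> = M * (1 / c) powr (2 / (1 + e)) * (1 / ?D n) powr (2 / (1 + e))"
      using c D1[of n] by (simp add: powr_divide powr_mult)
    also have "\<dots> \<le> M * (1 / c) powr (2 / (1 + e)) * ((real_of_int M ^ 3 * C\<^sup>2) powr \<gamma> * \<bar>x' - y'\<bar> powr \<gamma>)"
      using fin M2 by (intro mult_left_mono) auto
    finally show ?thesis by (simp add: mult.assoc)
  qed
qed

section \<open>Transfer of null sets and the limit\<close>

text \<open>Points outside the Jarnik set fall into countably many pieces \<open>K N\<close>, on
  each of which the insertion has a Hoelder inverse with a constant depending on \<open>N\<close>.
  The remaining points are null already, since \<open>\<gamma> * s \<le> s\<close>.\<close>

lemma hausdorff_null_F_set:
  assumes B: "finite B" "\<forall>b\<in>B. 2 \<le> b" "2 \<in> B" "\<beta> \<in> B" "3 \<le> \<beta>" and e: "0 < e" and s: "0 < s"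
    and null: "hausdorff_null (1 / (1 + e) ^ 4 * s) (jarnik_set (2 + e) \<inter> F_set B)"
  shows "hausdorff_null s (F_set B)"
proof -
  define M where "M = int (Max B)"
  have M: "b \<le> M" if "b \<in> int ` B" for b using that B by (auto simp: M_def)
  have \<beta>: "2 \<le> int \<beta>" "int \<beta> \<le> M" using B M by auto
  \<comment> \<open>\<open>S\<close> depends only on \<open>e\<close> and \<open>M\<close>, so one
    insertion map \<open>f\<close> serves all points and all pieces.\<close>
  obtain S where S: "infinite S" "\<And>a k. a \<in> S \<Longrightarrow> k \<in> S \<Longrightarrow> a < k \<Longrightarrow> den_bound e M a \<le> real k powr e"
    using sparse_set_exists[OF e, of "den_bound e M"] by blast
  define K where "K N = F_set B \<inter> badly_approx (2 + e) (1 / (real N + 1))" for N :: nat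
  have "\<exists>b t. bcf_expansion x b t \<and> (\<forall>n. b n \<in> int ` B)" if "x \<in> F_set B" for x
    using that F_set_iff by blast
  then obtain b t where b: "\<And>x. x \<in> F_set B \<Longrightarrow> bcf_expansion x (b x) (t x)"
    "\<And>x n. x \<in> F_set B \<Longrightarrow> b x n \<in> int ` B"
    by metis
  have "\<exists>x' t'. bcf_expansion x' (inserted_seq e (int \<beta>) S (b x)) t' \<and> x' \<in> jarnik_set (2 + e) \<inter> F_set B"
    if x: "x \<in> F_set B" for x
  proof -
    let ?B = "inserted_seq e (int \<beta>) S (b x)"
    have mem: "?B i \<in> int ` B" for i
      using inserted_seq_in[of e "int \<beta>" S "b x" i] b(2)[OF x] B by (auto intro: image_eqI[of _ _ 2])
    obtain x' t' where x': "bcf_expansion x' ?B t'"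
    proof (rule bcf_expansion_exists[THEN exE])
      show "2 \<le> ?B n" for n using mem[of n] B by auto
      show "\<exists>m\<ge>n. ?B m \<noteq> 2" for n
      proof -
        obtain m where "n \<le> m" "?B m = int \<beta>" using inserted_seq_frequently[OF S(1)] by blast
        then show ?thesis using B(5) by (intro exI[of _ m]) auto
      qed
    qed blast
    have "x' \<in> F_set B" using x' mem F_set_iff by blast
    moreover have "x' \<in> jarnik_set (2 + e)"
      using x' S(1) e bcf_expansionD(6)[OF b(1)[OF x]] \<beta>(1) by (rule jarnik_set_if_inserted_runs)
    ultimately show ?thesis using x' by blast
  qed
  then obtain f t' where f: "\<And>x. x \<in> F_set B \<Longrightarrow> bcf_expansion (f x) (inserted_seq e (int \<beta>) S (b x)) (t' x)"
    "\<And>x. x \<in> F_set B \<Longrightarrow> f x \<in> jarnik_set (2 + e) \<inter> F_set B" by metis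
  have "hausdorff_null s (K N)" for N
  proof (rule hausdorff_null_inverse_Holder[OF null])
    let ?c = "1 / (real N + 1)" and ?\<gamma> = "1 / (1 + e) ^ 4"
    let ?C = "3 * real_of_int M * (1 / ?c) powr ((1 + e)^2)"
    show "f ` K N \<subseteq> jarnik_set (2 + e) \<inter> F_set B" using f(2) by (auto simp: K_def)
    show "0 < s" "0 < ?\<gamma>" using s e by auto
    show "0 < M * (1 / ?c) powr (2 / (1 + e)) * (real_of_int M ^ 3 * ?C\<^sup>2) powr ?\<gamma>"
      using \<beta> by simp
    show "\<bar>x - y\<bar> \<le> M * (1 / ?c) powr (2 / (1 + e)) * (real_of_int M ^ 3 * ?C\<^sup>2) powr ?\<gamma> * \<bar>f x - f y\<bar> powr ?\<gamma>"
      if "x \<in> K N" "y \<in> K N" for x y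
    proof -
      have x: "x \<in> F_set B" and y: "y \<in> F_set B" and bad: "x \<in> badly_approx (2 + e) ?c"
        using that by (auto simp: K_def)
      show ?thesis
        using b(1)[OF x] b(1)[OF y] f(1)[OF x] f(1)[OF y] M[OF b(2)[OF x]] M[OF b(2)[OF y]] \<beta> e S(2) _ _ bad
        by (rule insertion_inverse_Holder) (auto simp: field_simps)
    qed
  qed
  then have "hausdorff_null s (\<Union>N. K N)" by (rule hausdorff_null_UN)
  moreover have "hausdorff_null s (jarnik_set (2 + e) \<inter> F_set B)"
  proof (rule hausdorff_null_exponent_mono[OF null])
    have "1 \<le> (1 + e) ^ 4" using e by simp
    then show "0 < 1 / (1 + e) ^ 4 * s" "1 / (1 + e) ^ 4 * s \<le> s" using s e by (auto simp: field_simps)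
  qed
  moreover have "F_set B \<subseteq> (\<Union>N. K N) \<union> (jarnik_set (2 + e) \<inter> F_set B)"
    using not_jarnik_badly_approx[of _ "2 + e"] by (fastforce simp: K_def F_set_def)
  ultimately show ?thesis by (metis hausdorff_null_Un hausdorff_null_subset)
qed

theorem theorem1:
  fixes B :: "nat set"
  assumes "finite B" and "\<forall>b\<in>B. 2 \<le> b" and "card B \<ge> 2" and "2 \<in> B"
  shows "((\<lambda>\<alpha>. hausdorff_dim (jarnik_set \<alpha> \<inter> F_set B)) \<longlongrightarrow> hausdorff_dim (F_set B))
           (at_right 2)"
proof -
  \<comment> \<open>A digit other than 2 is needed to close the inserted runs.\<close>
  obtain \<beta> where \<beta>: "\<beta> \<in> B" "3 \<le> \<beta>"
  proof -
    have "\<not> B \<subseteq> {2}"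
    proof
      assume "B \<subseteq> {2}"
      then have "card B \<le> card {2 :: nat}" by (intro card_mono) auto
      then show False using assms(3) by simp
    qed
    then obtain \<beta> where "\<beta> \<in> B" "\<beta> \<noteq> 2" by blast
    then show ?thesis using assms(2) that[of \<beta>] by fastforce
  qed
  let ?D = "hausdorff_dim (F_set B)" and ?G = "\<lambda>\<alpha>. jarnik_set \<alpha> \<inter> F_set B"
  have F: "F_set B \<subseteq> {0..1}" by (auto simp: F_set_def)
  then have G: "?G \<alpha> \<subseteq> {0..1}" for \<alpha> by blast
  have lower: "?D / (\<alpha> - 1) ^ 4 \<le> hausdorff_dim (?G \<alpha>)" if "2 < \<alpha>" for \<alpha>
  proof (rule ccontr)
    define e where "e = \<alpha> - 2"
    have e: "0 < e" "\<alpha> = 2 + e" "\<alpha> - 1 = 1 + e" using that by (auto simp: e_def)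
    assume "\<not> ?D / (\<alpha> - 1) ^ 4 \<le> hausdorff_dim (?G \<alpha>)"
    then obtain r where r: "hausdorff_dim (?G \<alpha>) < r" "r < ?D / (1 + e) ^ 4"
      using dense[of "hausdorff_dim (?G \<alpha>)" "?D / (1 + e) ^ 4"] e by auto
    have "0 < r" using r(1) hausdorff_dim_nonneg[OF G, of \<alpha>] by linarith
    \<comment> \<open>Chosen so that \<open>\<gamma> * s = r\<close>: nullity of the Jarnik part at
      exponent \<open>r\<close> then passes to \<open>F_set B\<close> at the exponent
      \<open>s\<close>, below its dimension.\<close>
    define s where "s = r * (1 + e) ^ 4"
    have s: "0 < s" "s < ?D" "1 / (1 + e) ^ 4 * s = r"
      using e \<open>0 < r\<close> r(2) by (auto simp: s_def field_simps)
    have "hausdorff_null (1 / (1 + e) ^ 4 * s) (jarnik_set (2 + e) \<inter> F_set B)"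
      using hausdorff_null_if_dim_less[OF G r(1)] s e by simp
    then have "hausdorff_null s (F_set B)"
      using assms \<beta> e s by (intro hausdorff_null_F_set[of B \<beta> e s]) auto
    then show False using hausdorff_dim_le s by fastforce
  qed
  show ?thesis
  proof (rule tendsto_sandwich)
    show "\<forall>\<^sub>F \<alpha> in at_right 2. ?D / (\<alpha> - 1) ^ 4 \<le> hausdorff_dim (?G \<alpha>)"
      using lower by (auto simp: eventually_at_filter)
    show "\<forall>\<^sub>F \<alpha> in at_right 2. hausdorff_dim (?G \<alpha>) \<le> ?D"
      using F by (intro always_eventually allI hausdorff_dim_mono) auto
    have "((\<lambda>\<alpha>. ?D / (\<alpha> - 1) ^ 4) \<longlongrightarrow> ?D / (2 - 1) ^ 4) (at_right 2)"
      by (intro tendsto_intros) auto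
    then show "((\<lambda>\<alpha>. ?D / (\<alpha> - 1) ^ 4) \<longlongrightarrow> ?D) (at_right 2)" by simp
  qed simp
qed


end
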